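(* The connection $\nabla^{\mathrm{cl}}$ on $\Omega$ is flat, and its torsion satisfies $\mathrm{Tor}^{\nabla^{\mathrm{cl}}}(X_u,X_v)=X_{u\Delta v-v\Delta u}$ for all $u,v\in V$. For every $v\in V$, the integral curves of the field $X_v$ are $\nabla^{\mathrm{cl}}$-geodesics and are given by $\eta_{x,v}(t)=e^{t\underline v}\,x\,e^{t\underline v^{\top}}$, $x\in\Omega$. For every $x,y\in\Omega$, if $v_{x,y}\in V$ is defined by $\underline{v_{x,y}}=T_x\log(T_x^{-1}T_y)T_x^{-1}$, then $\eta_{x,v_{x,y}}(t)=\gamma^{\mathrm{cv}}_{x,y}(t)$ for $0\le t\le 1$. Hence the Cholesky-Vinberg path is also a $\nabla^{\mathrm{cl}}$-geodesic.
   Context: Let $V\subset \mathrm{Sym}(3,\mathbb{R})$ be the 5-dimensional space of real symmetric $3\times3$ matrices whose $(1,2)$ and $(2,1)$ entries are $0$, and let $\Omega\subset V$ be the open cone of positive definite matrices in $V$. Let $H$ be the Lie group of real lower triangular $3\times 3$ matrices with positive diagonal entries and zero $(2,1)$ entry, with Lie algebra $\mathfrak{h}$ the lower triangular $3\times3$ matrices with zero $(2,1)$ entry. The map $\Phi:H\to\Omega$, $\Phi(T)=TT^{\top}$, is a diffeomorphism; $T_x:=\Phi^{-1}(x)\in H$. For $T\in H$, $\log T\in\mathfrak h$ is the principal logarithm and $T^t:=\exp(t\log T)$. The Cholesky-Vinberg path is $\gamma^{\mathrm{cv}}_{x,y}(t):=\Phi\bigl(T_x(T_x^{-1}T_y)^t\bigr)$,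 $0\le t\le1$. For $u\in V$ let $\underline{u}\in\mathfrak h$ be the unique element with $u=\underline u+\underline u^{\top}$ ($u\mapsto\underline u$ is a linear isomorphism $V\to\mathfrak h$); the clan product on $V$ is $u\Delta w=\underline u\,w+w\,\underline u^{\top}$. The clan vector field of $v\in V$ on $\Omega$ is $X_v(x)=v\Delta x=\underline v\,x+x\,\underline v^{\top}$. The connection $\nabla^{\mathrm{cl}}$ is the pushforward by $\Phi$ of the unique right-invariant affine connection on $H$ for which all right-invariant vector fields $E^r_A(T)=AT$, $A\in\mathfrak h$, are parallel; equivalently, it is the unique affine connection on $\Omega$ with $\nabla^{\mathrm{cl}}_{X_u}X_v=0$ for all $u,v\in V$. Torsion convention: $\mathrm{Tor}^\nabla(X,Y)=\nabla_XY-\nabla_YX-[X,Y]$. *)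

theory Defs
  imports "HOL-Analysis.Analysis"
begin

section \<open>Calculus on relatively open subsets of a linear subspace\<close>

text \<open>
  The manifolds below are sets M that are relatively open in a linear subspace E of a Euclidean
  space, so that E is the tangent space of M at each of its points. A function on M is
  represented by a total function of which only the values on M matter.

  If E is a proper subspace, a Frechet derivative within M is determined only on E. This is
  harmless, because directional derivatives are only ever taken in directions from E.
\<close>

definition dird :: "'a::euclidean_space set \<Rightarrow> ('a \<Rightarrow> 'b::euclidean_space) \<Rightarrow> 'a \<Rightarrow> 'a \<Rightarrow> 'b" where
  "dird M f x v = frechet_derivative f (at x within M) v"

primrec Ck_on :: "nat \<Rightarrow> 'a::euclidean_space set \<Rightarrow> 'a set \<Rightarrow> ('a \<Rightarrow> 'b::euclidean_space) \<Rightarrow> bool" where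
  "Ck_on 0 E M f = continuous_on M f"
| "Ck_on (Suc k) E M f =
     (f differentiable_on M \<and> (\<forall>v\<in>E. Ck_on k E M (\<lambda>x. dird M f x v)))"

definition smooth_on :: "'a::euclidean_space set \<Rightarrow> 'a set \<Rightarrow> ('a \<Rightarrow> 'b::euclidean_space) \<Rightarrow> bool" where
  "smooth_on E M f \<longleftrightarrow> (\<forall>k. Ck_on k E M f)"

text \<open>Vector fields are normalised to vanish outside M, so that equality of vector fields is
  equality of functions.\<close>

definition vector_fields :: "'a::euclidean_space set \<Rightarrow> 'a set \<Rightarrow> ('a \<Rightarrow> 'a) set" where
  "vector_fields E M = {X. (\<forall>x\<in>M. X x \<in> E) \<and> (\<forall>x. x \<notin> M \<longrightarrow> X x = 0) \<and> smooth_on E M X}"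

definition lie_bracket :: "'a::euclidean_space set \<Rightarrow> ('a \<Rightarrow> 'a) \<Rightarrow> ('a \<Rightarrow> 'a) \<Rightarrow> 'a \<Rightarrow> 'a" where
  "lie_bracket M X Y = (\<lambda>x. if x \<in> M then dird M Y x (X x) - dird M X x (Y x) else 0)"

section \<open>Affine connections\<close>

type_synonym 'a conn = "('a \<Rightarrow> 'a) \<Rightarrow> ('a \<Rightarrow> 'a) \<Rightarrow> 'a \<Rightarrow> 'a"

text \<open>The last conjunct only fixes the junk value of a connection on arguments that are not vector
  fields; it is needed for connections to be unique as HOL functions.\<close>

definition affine_connection :: "'a::euclidean_space set \<Rightarrow> 'a set \<Rightarrow> 'a conn \<Rightarrow> bool" where
  "affine_connection E M D \<longleftrightarrow>
    (\<forall>X\<in>vector_fields E M. \<forall>Y\<in>vector_fields E M. D X Y \<in> vector_fields E M) \<and>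
    (\<forall>X\<in>vector_fields E M. \<forall>X'\<in>vector_fields E M. \<forall>Y\<in>vector_fields E M.
       D (\<lambda>x. X x + X' x) Y = (\<lambda>x. D X Y x + D X' Y x)) \<and>
    (\<forall>f. smooth_on E M f \<longrightarrow> (\<forall>X\<in>vector_fields E M. \<forall>Y\<in>vector_fields E M.
       D (\<lambda>x. f x *\<^sub>R X x) Y = (\<lambda>x. f x *\<^sub>R D X Y x))) \<and>
    (\<forall>X\<in>vector_fields E M. \<forall>Y\<in>vector_fields E M. \<forall>Y'\<in>vector_fields E M.
       D X (\<lambda>x. Y x + Y' x) = (\<lambda>x. D X Y x + D X Y' x)) \<and>
    (\<forall>f. smooth_on E M f \<longrightarrow> (\<forall>X\<in>vector_fields E M. \<forall>Y\<in>vector_fields E M.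
       D X (\<lambda>x. f x *\<^sub>R Y x) = (\<lambda>x. dird M f x (X x) *\<^sub>R Y x + f x *\<^sub>R D X Y x))) \<and>
    (\<forall>X Y. X \<notin> vector_fields E M \<or> Y \<notin> vector_fields E M \<longrightarrow> D X Y = (\<lambda>x. 0))"

definition parallel_field :: "'a::euclidean_space set \<Rightarrow> 'a set \<Rightarrow> 'a conn \<Rightarrow> ('a \<Rightarrow> 'a) \<Rightarrow> bool" where
  "parallel_field E M D Y \<longleftrightarrow> (\<forall>X\<in>vector_fields E M. D X Y = (\<lambda>x. 0))"

definition torsion :: "'a::euclidean_space set \<Rightarrow> 'a conn \<Rightarrow> 'a conn" where
  "torsion M D X Y = (\<lambda>x. D X Y x - D Y X x - lie_bracket M X Y x)"

definition curvature ::
  "'a::euclidean_space set \<Rightarrow> 'a conn \<Rightarrow> ('a \<Rightarrow> 'a) \<Rightarrow> ('a \<Rightarrow> 'a) \<Rightarrow> ('a \<Rightarrow> 'a) \<Rightarrow> 'a \<Rightarrow> 'a" where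
  "curvature M D X Y Z = (\<lambda>x. D X (D Y Z) x - D Y (D X Z) x - D (lie_bracket M X Y) Z x)"

definition flat_connection :: "'a::euclidean_space set \<Rightarrow> 'a set \<Rightarrow> 'a conn \<Rightarrow> bool" where
  "flat_connection E M D \<longleftrightarrow>
    (\<forall>X\<in>vector_fields E M. \<forall>Y\<in>vector_fields E M. \<forall>Z\<in>vector_fields E M.
       curvature M D X Y Z = (\<lambda>x. 0))"

text \<open>Push-forward along a diffeomorphism phi with inverse psi, onto the manifold N.\<close>

definition push_field ::
  "'a::euclidean_space set \<Rightarrow> 'a set \<Rightarrow> ('a \<Rightarrow> 'a) \<Rightarrow> ('a \<Rightarrow> 'a) \<Rightarrow> ('a \<Rightarrow> 'a) \<Rightarrow> 'a \<Rightarrow> 'a" where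
  "push_field M N \<phi> \<psi> X = (\<lambda>y. if y \<in> N then dird M \<phi> (\<psi> y) (X (\<psi> y)) else 0)"

definition push_conn ::
  "'a::euclidean_space set \<Rightarrow> 'a set \<Rightarrow> 'a set \<Rightarrow> ('a \<Rightarrow> 'a) \<Rightarrow> ('a \<Rightarrow> 'a) \<Rightarrow> 'a conn \<Rightarrow> 'a conn" where
  "push_conn M F N \<phi> \<psi> D X Y =
    (if X \<in> vector_fields F N \<and> Y \<in> vector_fields F N
     then push_field M N \<phi> \<psi> (D (push_field N M \<psi> \<phi> X) (push_field N M \<psi> \<phi> Y))
     else (\<lambda>y. 0))"

section \<open>Curves\<close>

text \<open>Curves are parametrised by intervals with nonempty interior, not necessarily open;
  derivatives at an endpoint are one-sided.\<close>

definition param_interval :: "real set \<Rightarrow> bool" where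
  "param_interval I \<longleftrightarrow> is_interval I \<and> interior I \<noteq> {}"

definition integral_curve ::
  "'a::euclidean_space set \<Rightarrow> ('a \<Rightarrow> 'a) \<Rightarrow> real set \<Rightarrow> (real \<Rightarrow> 'a) \<Rightarrow> bool" where
  "integral_curve M X I c \<longleftrightarrow> param_interval I \<and>
    (\<forall>t\<in>I. c t \<in> M \<and> (c has_vector_derivative X (c t)) (at t within I))"

definition const_field :: "'a::euclidean_space set \<Rightarrow> 'a \<Rightarrow> 'a \<Rightarrow> 'a" where
  "const_field M v = (\<lambda>x. if x \<in> M then v else 0)"

text \<open>The Christoffel form of a connection in the global affine chart M of E.\<close>

definition christoffel :: "'a::euclidean_space set \<Rightarrow> 'a conn \<Rightarrow> 'a \<Rightarrow> 'a \<Rightarrow> 'a \<Rightarrow> 'a" where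
  "christoffel M D x v w = D (const_field M v) (const_field M w) x"

definition cov_deriv_along :: "'a::euclidean_space set \<Rightarrow> 'a conn \<Rightarrow> real set \<Rightarrow> (real \<Rightarrow> 'a) \<Rightarrow>
    (real \<Rightarrow> 'a) \<Rightarrow> real \<Rightarrow> 'a" where
  "cov_deriv_along M D I c Y t =
    vector_derivative Y (at t within I)
      + christoffel M D (c t) (vector_derivative c (at t within I)) (Y t)"

definition geodesic ::
  "'a::euclidean_space set \<Rightarrow> 'a conn \<Rightarrow> real set \<Rightarrow> (real \<Rightarrow> 'a) \<Rightarrow> bool" where
  "geodesic M D I c \<longleftrightarrow> param_interval I \<and> smooth_on UNIV I c \<and> c ` I \<subseteq> M \<and>
    (\<forall>t\<in>I. cov_deriv_along M D I c (\<lambda>s. vector_derivative c (at s within I)) t = 0)"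

section \<open>Matrix exponential and principal logarithm\<close>

type_synonym mat3 = "real^3^3"

text \<open>The product on the type of matrices is entrywise, hence the library constants for powers and
  the exponential function cannot be used.\<close>

definition mexp :: "mat3 \<Rightarrow> mat3" where
  "mexp A = (\<Sum>n. (1 / fact n) *\<^sub>R (((**) A ^^ n) (mat 1)))"

definition complex_eigenvalue :: "mat3 \<Rightarrow> complex \<Rightarrow> bool" where
  "complex_eigenvalue A z \<longleftrightarrow>
    (\<exists>w::complex^3. w \<noteq> 0 \<and> (\<chi> i j. complex_of_real (A$i$j)) *v w = z *s w)"

text \<open>The principal logarithm of a matrix without eigenvalues in the closed negative real axis;
  for a real matrix it is real.\<close>

definition mlog :: "mat3 \<Rightarrow> mat3" where
  "mlog T = (THE L. mexp L = T \<and> (\<forall>z. complex_eigenvalue L z \<longrightarrow> - pi < Im z \<and> Im z < pi))"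

definition mpow :: "mat3 \<Rightarrow> real \<Rightarrow> mat3" where
  "mpow T t = mexp (t *\<^sub>R mlog T)"

section \<open>The cone and its clan structure\<close>

definition Vsp :: "mat3 set" where
  "Vsp = {A. transpose A = A \<and> A$1$2 = 0 \<and> A$2$1 = 0}"

definition Omega :: "mat3 set" where
  "Omega = {A \<in> Vsp. \<forall>z. z \<noteq> 0 \<longrightarrow> z \<bullet> (A *v z) > 0}"

text \<open>The order on the index type 3 is not the naive one (there 3 = 0), so triangularity is
  spelled out.\<close>

definition hlie :: "mat3 set" where
  "hlie = {A. A$1$2 = 0 \<and> A$1$3 = 0 \<and> A$2$3 = 0 \<and> A$2$1 = 0}"

definition Hgrp :: "mat3 set" where
  "Hgrp = {T \<in> hlie. \<forall>i. T$i$i > 0}"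

definition Phi :: "mat3 \<Rightarrow> mat3" where
  "Phi T = T ** transpose T"

definition chol :: "mat3 \<Rightarrow> mat3" where
  "chol = inv_into Hgrp Phi"

definition cv_path :: "mat3 \<Rightarrow> mat3 \<Rightarrow> real \<Rightarrow> mat3" where
  "cv_path x y t = Phi (chol x ** mpow (matrix_inv (chol x) ** chol y) t)"

definition low :: "mat3 \<Rightarrow> mat3" where
  "low u = (THE A. A \<in> hlie \<and> u = A + transpose A)"

definition clan_prod :: "mat3 \<Rightarrow> mat3 \<Rightarrow> mat3" (infixl "\<Delta>" 70) where
  "u \<Delta> w = low u ** w + w ** transpose (low u)"

definition clan_field :: "mat3 \<Rightarrow> mat3 \<Rightarrow> mat3" where
  "clan_field v = (\<lambda>x. if x \<in> Omega then v \<Delta> x else 0)"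

definition eta :: "mat3 \<Rightarrow> mat3 \<Rightarrow> real \<Rightarrow> mat3" where
  "eta x v t = mexp (t *\<^sub>R low v) ** x ** mexp (t *\<^sub>R transpose (low v))"

definition cv_vec :: "mat3 \<Rightarrow> mat3 \<Rightarrow> mat3" where
  "cv_vec x y = (THE v. v \<in> Vsp \<and>
     low v = chol x ** mlog (matrix_inv (chol x) ** chol y) ** matrix_inv (chol x))"

section \<open>The clan connection\<close>

definition right_inv_field :: "mat3 \<Rightarrow> mat3 \<Rightarrow> mat3" where
  "right_inv_field A = (\<lambda>T. if T \<in> Hgrp then A ** T else 0)"

definition right_invariant :: "mat3 conn \<Rightarrow> bool" where
  "right_invariant D \<longleftrightarrow>
    (\<forall>S\<in>Hgrp. push_conn Hgrp hlie Hgrp (\<lambda>T. T ** S) (\<lambda>T. T ** matrix_inv S) D = D)"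

definition nabla_H :: "mat3 conn" where
  "nabla_H = (THE D. affine_connection hlie Hgrp D \<and> right_invariant D \<and>
     (\<forall>A\<in>hlie. parallel_field hlie Hgrp D (right_inv_field A)))"

definition nabla_cl :: "mat3 conn" where
  "nabla_cl = push_conn Hgrp Vsp Omega Phi chol nabla_H"

end

theory Submission
  imports Defs "HOL-Computational_Algebra.Fundamental_Theorem_Algebra"
begin

text \<open>
  A smooth trivialisation of the tangent bundle has exactly one affine connection for which the
  constant sections are parallel: differentiate the coordinates. Such a connection is flat because
  mixed derivatives commute, and a diffeomorphism that matches two trivialisations transports one
  connection into the other. On the group the trivialisation is w \<mapsto> w T^-1, on the cone it sends w
  to the A with A x + x A^T = w, and the differential of Phi matches the two; this identifies
  nabla_cl. A field X with D X X = 0 has geodesic integral curves, which for clan fields solve a linear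
  equation. Finally T (T^-1 S)^t = exp(t T L T^-1) T for L = log (T^-1 S), so the Cholesky-Vinberg
  path is one of these curves.

  The principal logarithm needs an argument for uniqueness: a logarithm of an element of Hgrp with
  spectrum in the strip has real spectrum, so the entries of exp(t L) are exponential polynomials
  with real exponents, which are determined by their values at the natural numbers.
\<close>

section \<open>Differential calculus on relatively open sets\<close>

text \<open>Two obstacles shape the development. A derivative within \<open>M\<close> is determined
  only along \<open>E\<close>, and curves live on intervals that may contain their endpoints. The
  calculus therefore rests on a weak condition: \<open>x + d v\<close> meets \<open>M\<close> for
  arbitrarily small nonzero \<open>d\<close>, whose sign is free so that endpoints qualify. Relative
  openness enters where directions vary with the point and where second derivatives are exchanged.
  The other obstacle is that \<open>nabla_H\<close>, \<open>chol\<close>, \<open>low\<close>,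
  \<open>mlog\<close> and \<open>cv_vec\<close> are given by choice or definite description. Each
  has to be pinned down by a witness and a uniqueness argument before anything can be computed; for
  \<open>mlog\<close> the competitors are arbitrary real matrices, not only triangular ones.
  Smoothness of \<open>chol\<close> and \<open>matrix_inv\<close> is read off from explicit formulas
  in square roots and inverses of entries.\<close>

locale feasible_domain =
  fixes E M :: "'a::euclidean_space set"
  assumes feasible:
    "\<lbrakk>x \<in> M; v \<in> E; e > 0\<rbrakk> \<Longrightarrow> \<exists>d::real. 0 < \<bar>d\<bar> \<and> \<bar>d\<bar> < e \<and> x + d *\<^sub>R v \<in> M"

lemma has_derivative_compose_within:
  assumes "(f has_derivative f') (at x within S)" "(g has_derivative g') (at (f x) within T)" "f ` S \<subseteq> T"
  shows "((\<lambda>x. g (f x)) has_derivative (\<lambda>v. g' (f' v))) (at x within S)"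
  by (rule has_derivative_in_compose[OF assms(1) has_derivative_subset[OF assms(2,3)]])

text \<open>Functions that agree on \<open>M\<close> have the same derivatives at \<open>x\<close>
  within \<open>M\<close>, so the choice made by \<open>frechet_derivative\<close> is the same.
  Hence the equality holds in every direction, also outside \<open>E\<close>, where the derivative
  is not determined.\<close>

lemma dird_transform:
  assumes "\<And>x. x \<in> M \<Longrightarrow> f x = g x" "x \<in> M"
  shows "dird M f x = dird M g x"
proof -
  have "(f has_derivative f') (at x within M) \<longleftrightarrow> (g has_derivative f') (at x within M)" for f'
    using assms has_derivative_transform[of x M] by metis
  then show ?thesis
    by (simp add: dird_def[abs_def] frechet_derivative_def fun_eq_iff)
qed

lemma Ck_on_cong:
  assumes "\<And>x. x \<in> M \<Longrightarrow> f x = g x"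
  shows "Ck_on k E M f \<longleftrightarrow> Ck_on k E M g"
  using assms
proof (induction k arbitrary: f g)
  case 0
  then show ?case
    by (simp cong: continuous_on_cong)
next
  case (Suc k)
  have "f differentiable_on M \<longleftrightarrow> g differentiable_on M"
    using Suc.prems has_derivative_transform[of _ M]
    unfolding differentiable_on_def differentiable_def by metis
  moreover have "Ck_on k E M (\<lambda>x. dird M f x v) \<longleftrightarrow> Ck_on k E M (\<lambda>x. dird M g x v)" for v
    by (rule Suc.IH) (simp add: dird_transform[OF Suc.prems])
  ultimately show ?case
    by simp
qed

lemma Ck_on_Suc_imp:
  "Ck_on (Suc k) E M f \<Longrightarrow> Ck_on k E M f"
  by (induction k arbitrary: f) (auto intro: differentiable_imp_continuous_on)

lemma Ck_on_has_derivative: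
  "\<lbrakk>Ck_on (Suc k) E M f; x \<in> M\<rbrakk> \<Longrightarrow> (f has_derivative dird M f x) (at x within M)"
  by (simp add: differentiable_on_def frechet_derivative_works dird_def[abs_def])

lemma Ck_on_dird:
  "\<lbrakk>Ck_on (Suc k) E M f; v \<in> E\<rbrakk> \<Longrightarrow> Ck_on k E M (\<lambda>x. dird M f x v)"
  by simp

lemma smooth_on_has_derivative:
  "\<lbrakk>smooth_on E M f; x \<in> M\<rbrakk> \<Longrightarrow> (f has_derivative dird M f x) (at x within M)"
  using Ck_on_has_derivative smooth_on_def by blast

lemma smooth_on_dird:
  "\<lbrakk>smooth_on E M f; v \<in> E\<rbrakk> \<Longrightarrow> smooth_on E M (\<lambda>x. dird M f x v)"
  unfolding smooth_on_def using Ck_on_dird by blast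

lemma smooth_on_cong:
  "(\<And>x. x \<in> M \<Longrightarrow> f x = g x) \<Longrightarrow> smooth_on E M f \<longleftrightarrow> smooth_on E M g"
  unfolding smooth_on_def by (simp cong: Ck_on_cong)

context feasible_domain
begin

text \<open>Restriction to the line \<open>x + d v\<close> leaves one real variable. Feasibility
  makes 0 a limit point of the admissible parameters \<open>?S\<close>, as uniqueness of a
  derivative within a set requires.\<close>

lemma has_derivative_unique_on:
  assumes f1: "(f has_derivative f1) (at x within M)"
    and f2: "(f has_derivative f2) (at x within M)"
    and x: "x \<in> M" and v: "v \<in> E"
  shows "f1 v = f2 v"
proof -
  let ?S = "{d::real. x + d *\<^sub>R v \<in> M}"
  have *: "((\<lambda>d. f (x + d *\<^sub>R v)) has_derivative (\<lambda>d. f' (d *\<^sub>R v))) (at 0 within ?S)"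
    if "(f has_derivative f') (at x within M)" for f'
  proof (rule has_derivative_compose_within[where T=M])
    show "((\<lambda>d. x + d *\<^sub>R v) has_derivative (\<lambda>d. d *\<^sub>R v)) (at 0 within ?S)"
      by (auto intro!: derivative_eq_intros)
  qed (use that in auto)
  have "(\<lambda>d::real. f1 (d *\<^sub>R v)) = (\<lambda>d. f2 (d *\<^sub>R v))"
    by (rule frechet_derivative_unique_within[OF *[OF f1] *[OF f2]])
      (use feasible[OF x v] in auto)
  then show ?thesis
    by (metis scaleR_one)
qed

lemma dird_eq:
  assumes "(f has_derivative f') (at x within M)" "x \<in> M" "v \<in> E"
  shows "dird M f x v = f' v"
proof -
  have "(f has_derivative dird M f x) (at x within M)"
    using assms(1) unfolding dird_def[abs_def] frechet_derivative_works[symmetric] differentiable_def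
    by blast
  then show ?thesis
    using has_derivative_unique_on assms by blast
qed

text \<open>Any family of derivatives may stand in for the chosen ones, since only directions in
  \<open>E\<close> matter. The inductive closure rules below rest on this.\<close>

lemma Ck_on_SucI:
  assumes "\<And>x. x \<in> M \<Longrightarrow> (f has_derivative f' x) (at x within M)"
    and "\<And>v. v \<in> E \<Longrightarrow> Ck_on k E M (\<lambda>x. f' x v)"
  shows "Ck_on (Suc k) E M f"
proof -
  have "Ck_on k E M (\<lambda>x. dird M f x v) \<longleftrightarrow> Ck_on k E M (\<lambda>x. f' x v)" if "v \<in> E" for v
    by (rule Ck_on_cong) (use dird_eq assms(1) that in blast)
  then show ?thesis
    using assms by (auto simp: differentiable_on_def differentiable_def)
qed

text \<open>Orthogonality detects the subspace: for \<open>n\<close> orthogonal to \<open>F\<close>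
  the function \<open>n \<bullet> g\<close> vanishes on \<open>M\<close>, hence so does its
  derivative along \<open>v\<close>, and the double orthogonal complement of \<open>F\<close> is
  \<open>F\<close>.\<close>

lemma has_derivative_in_subspace:
  fixes g :: "'a \<Rightarrow> 'b::euclidean_space"
  assumes g: "(g has_derivative g') (at x within M)" and F: "subspace F" "g ` M \<subseteq> F"
    and x: "x \<in> M" and v: "v \<in> E"
  shows "g' v \<in> F"
proof -
  have "n \<bullet> g' v = 0" if n: "n \<in> F\<^sup>\<bottom>" for n
  proof -
    have "((\<lambda>y. n \<bullet> g y) has_derivative (\<lambda>v. n \<bullet> g' v)) (at x within M)"
      using g by (auto intro: derivative_eq_intros)
    moreover have "n \<bullet> g y = 0" if "y \<in> M" for y
      using n F(2) that by (fastforce simp: orthogonal_comp_def orthogonal_def inner_commute)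
    then have "((\<lambda>y. n \<bullet> g y) has_derivative (\<lambda>v. 0)) (at x within M)"
      using has_derivative_transform[OF x _ has_derivative_const] by metis
    ultimately show ?thesis
      using has_derivative_unique_on x v by blast
  qed
  then have "g' v \<in> F\<^sup>\<bottom>\<^sup>\<bottom>"
    by (auto simp: orthogonal_comp_def orthogonal_def)
  then show ?thesis
    by (simp add: orthogonal_comp_self F)
qed

lemma Ck_on_const: "Ck_on k E M (\<lambda>x. c)"
proof (induction k arbitrary: c)
  case (Suc k)
  show ?case
    by (rule Ck_on_SucI[where f'="\<lambda>_ _. 0"]) (auto intro: Suc.IH)
qed simp

lemma Ck_on_bounded_linear:
  assumes "bounded_linear L" "Ck_on k E M f"
  shows "Ck_on k E M (\<lambda>x. L (f x))"
  using assms(2)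
proof (induction k arbitrary: f)
  case 0
  then show ?case
    using bounded_linear.continuous_on[OF assms(1)] by simp
next
  case (Suc k)
  show ?case
    by (rule Ck_on_SucI)
      (use bounded_linear.has_derivative[OF assms(1) Ck_on_has_derivative[OF Suc.prems]]
        Suc.IH[OF Ck_on_dird[OF Suc.prems]] in auto)
qed

lemma Ck_on_add:
  assumes "Ck_on k E M f" "Ck_on k E M g"
  shows "Ck_on k E M (\<lambda>x. f x + g x)"
  using assms
proof (induction k arbitrary: f g)
  case 0
  then show ?case
    by (simp add: continuous_on_add)
next
  case (Suc k)
  show ?case
    by (rule Ck_on_SucI[OF has_derivative_add[OF Ck_on_has_derivative[OF Suc.prems(1)]
          Ck_on_has_derivative[OF Suc.prems(2)]]])
      (use Suc.IH Ck_on_dird Suc.prems in blast)+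
qed

lemma Ck_on_sum:
  "(\<And>i. i \<in> I \<Longrightarrow> Ck_on k E M (f i)) \<Longrightarrow> Ck_on k E M (\<lambda>x. \<Sum>i\<in>I. f i x)"
  by (induction I rule: infinite_finite_induct) (auto intro: Ck_on_const Ck_on_add)

lemma Ck_on_bounded_bilinear:
  assumes B: "bounded_bilinear B" and "Ck_on k E M f" "Ck_on k E M g"
  shows "Ck_on k E M (\<lambda>x. B (f x) (g x))"
  using assms(2,3)
proof (induction k arbitrary: f g)
  case 0
  then show ?case
    using bounded_bilinear.continuous_on[OF B] by simp
next
  case (Suc k)
  show ?case
    by (rule Ck_on_SucI[OF bounded_bilinear.FDERIV[OF B Ck_on_has_derivative[OF Suc.prems(1)]
          Ck_on_has_derivative[OF Suc.prems(2)]]])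
      (intro Ck_on_add Suc.IH Ck_on_dird[OF Suc.prems(1)] Ck_on_dird[OF Suc.prems(2)]
        Ck_on_Suc_imp[OF Suc.prems(1)] Ck_on_Suc_imp[OF Suc.prems(2)] | assumption)+
qed

lemma Ck_on_ident: "Ck_on k E M (\<lambda>x. x)"
proof (cases k)
  case (Suc m)
  show ?thesis
    unfolding Suc by (rule Ck_on_SucI[OF has_derivative_ident Ck_on_const])
qed simp

text \<open>The derivative of \<open>inverse f\<close> is built from \<open>inverse f\<close> itself
  and the derivative of \<open>f\<close>, so the induction closes. It is written as nested products
  to suit the bilinear rule.\<close>

lemma Ck_on_inverse:
  fixes f :: "'a \<Rightarrow> real"
  assumes "Ck_on k E M f" "\<And>x. x \<in> M \<Longrightarrow> f x \<noteq> 0"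
  shows "Ck_on k E M (\<lambda>x. inverse (f x))"
  using assms(1)
proof (induction k)
  case 0
  then show ?case
    by (simp add: assms(2) continuous_on_inverse)
next
  case (Suc k)
  show ?case
  proof (rule Ck_on_SucI)
    show "((\<lambda>x. inverse (f x)) has_derivative
      (\<lambda>v. inverse (f x) * (- dird M f x v * inverse (f x)))) (at x within M)" if "x \<in> M" for x
      using Deriv.has_derivative_inverse[OF assms(2)[OF that] Ck_on_has_derivative[OF Suc.prems that]]
      by (simp add: mult.assoc)
    show "Ck_on k E M (\<lambda>x. inverse (f x) * (- dird M f x v * inverse (f x)))" if "v \<in> E" for v
      by (intro Ck_on_bounded_bilinear[OF bounded_bilinear_mult] Suc.IH Ck_on_Suc_imp[OF Suc.prems]
          Ck_on_bounded_linear[OF bounded_linear_minus[OF bounded_linear_ident]]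
          Ck_on_dird[OF Suc.prems that])
  qed
qed

lemma Ck_on_sqrt:
  fixes f :: "'a \<Rightarrow> real"
  assumes "Ck_on k E M f" and pos: "\<And>x. x \<in> M \<Longrightarrow> f x > 0"
  shows "Ck_on k E M (\<lambda>x. sqrt (f x))"
  using assms(1)
proof (induction k)
  case 0
  then show ?case
    by (simp add: continuous_on_real_sqrt)
next
  case (Suc k)
  have nz: "sqrt (f x) \<noteq> 0" if "x \<in> M" for x
    using pos[OF that] by simp
  show ?case
  proof (rule Ck_on_SucI)
    show "((\<lambda>x. sqrt (f x)) has_derivative
      (\<lambda>v. inverse (sqrt (f x)) * (dird M f x v * (1/2)))) (at x within M)" if "x \<in> M" for x
      using has_derivative_real_sqrt[OF pos[OF that] Ck_on_has_derivative[OF Suc.prems that]]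
      by (simp add: field_simps)
    show "Ck_on k E M (\<lambda>x. inverse (sqrt (f x)) * (dird M f x v * (1/2)))" if "v \<in> E" for v
      by (intro Ck_on_bounded_bilinear[OF bounded_bilinear_mult] Suc.IH Ck_on_Suc_imp[OF Suc.prems]
          Ck_on_inverse nz Ck_on_dird[OF Suc.prems that] Ck_on_const)
  qed
qed

lemma smooth_on_const: "smooth_on E M (\<lambda>x. c)"
  by (simp add: smooth_on_def Ck_on_const)

lemma smooth_on_ident: "smooth_on E M (\<lambda>x. x)"
  by (simp add: smooth_on_def Ck_on_ident)

lemma smooth_on_bounded_linear:
  "\<lbrakk>bounded_linear L; smooth_on E M f\<rbrakk> \<Longrightarrow> smooth_on E M (\<lambda>x. L (f x))"
  by (simp add: smooth_on_def Ck_on_bounded_linear)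

lemma smooth_on_bounded_bilinear:
  "\<lbrakk>bounded_bilinear B; smooth_on E M f; smooth_on E M g\<rbrakk> \<Longrightarrow> smooth_on E M (\<lambda>x. B (f x) (g x))"
  by (simp add: smooth_on_def Ck_on_bounded_bilinear)

lemma smooth_on_add:
  "\<lbrakk>smooth_on E M f; smooth_on E M g\<rbrakk> \<Longrightarrow> smooth_on E M (\<lambda>x. f x + g x)"
  by (simp add: smooth_on_def Ck_on_add)

lemma smooth_on_minus: "smooth_on E M f \<Longrightarrow> smooth_on E M (\<lambda>x. - f x)"
  using smooth_on_bounded_linear[OF bounded_linear_minus[OF bounded_linear_ident]] by blast

lemma smooth_on_diff:
  "\<lbrakk>smooth_on E M f; smooth_on E M g\<rbrakk> \<Longrightarrow> smooth_on E M (\<lambda>x. f x - g x)"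
  using smooth_on_add[OF _ smooth_on_minus] by fastforce

lemma smooth_on_sum:
  "(\<And>i. i \<in> I \<Longrightarrow> smooth_on E M (f i)) \<Longrightarrow> smooth_on E M (\<lambda>x. \<Sum>i\<in>I. f i x)"
  by (simp add: smooth_on_def Ck_on_sum)

lemma smooth_on_inverse:
  fixes f :: "'a \<Rightarrow> real"
  shows "\<lbrakk>smooth_on E M f; \<And>x. x \<in> M \<Longrightarrow> f x \<noteq> 0\<rbrakk> \<Longrightarrow> smooth_on E M (\<lambda>x. inverse (f x))"
  by (simp add: smooth_on_def Ck_on_inverse)

lemma smooth_on_sqrt:
  fixes f :: "'a \<Rightarrow> real"
  shows "\<lbrakk>smooth_on E M f; \<And>x. x \<in> M \<Longrightarrow> f x > 0\<rbrakk> \<Longrightarrow> smooth_on E M (\<lambda>x. sqrt (f x))"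
  by (simp add: smooth_on_def Ck_on_sqrt)

lemma dird_in_subspace:
  assumes "smooth_on E M f" "subspace F" "f ` M \<subseteq> F" "x \<in> M" "v \<in> E"
  shows "dird M f x v \<in> F"
  by (rule has_derivative_in_subspace[OF smooth_on_has_derivative[OF assms(1,4)] assms(2-5)])

lemma dird_const: "\<lbrakk>x \<in> M; v \<in> E\<rbrakk> \<Longrightarrow> dird M (\<lambda>x. c) x v = 0"
  using dird_eq[OF has_derivative_const] by blast

lemma dird_add:
  assumes "smooth_on E M f" "smooth_on E M g" "x \<in> M" "v \<in> E"
  shows "dird M (\<lambda>x. f x + g x) x v = dird M f x v + dird M g x v"
  by (rule dird_eq[OF has_derivative_add]) (rule smooth_on_has_derivative assms)+

lemma dird_bounded_linear:
  assumes "bounded_linear L" "smooth_on E M f" "x \<in> M" "v \<in> E"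
  shows "dird M (\<lambda>x. L (f x)) x v = L (dird M f x v)"
  by (rule dird_eq[OF bounded_linear.has_derivative[OF assms(1)]]) (rule smooth_on_has_derivative assms)+

lemma dird_bounded_bilinear:
  assumes "bounded_bilinear B" "smooth_on E M f" "smooth_on E M g" "x \<in> M" "v \<in> E"
  shows "dird M (\<lambda>x. B (f x) (g x)) x v = B (f x) (dird M g x v) + B (dird M f x v) (g x)"
  by (rule dird_eq[OF bounded_bilinear.FDERIV[OF assms(1)]]) (rule smooth_on_has_derivative assms)+

lemma dird_sum:
  assumes "\<And>i. i \<in> I \<Longrightarrow> smooth_on E M (f i)" "x \<in> M" "v \<in> E"
  shows "dird M (\<lambda>x. \<Sum>i\<in>I. f i x) x v = (\<Sum>i\<in>I. dird M (f i) x v)"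
  using assms
proof (induction I rule: infinite_finite_induct)
  case (insert i I)
  then show ?case
    by (simp add: dird_add[OF _ smooth_on_sum])
qed (simp_all add: dird_const)

end

section \<open>Linearity in the direction, relatively open sets and the chain rule\<close>

lemma linear_dird:
  assumes "smooth_on E M f" "x \<in> M"
  shows "linear (dird M f x)"
  using assms smooth_on_has_derivative has_derivative_linear by blast

text \<open>The condition asks for the expansion of vectors rather than for orthonormality itself;
  an orthonormal basis of \<open>E\<close> supplies the witness.\<close>

definition onb :: "'a::euclidean_space set \<Rightarrow> 'a set" where
  "onb E = (SOME B. finite B \<and> B \<subseteq> E \<and> (\<forall>w\<in>E. (\<Sum>b\<in>B. (w \<bullet> b) *\<^sub>R b) = w))"

locale rel_open =
  fixes E M :: "'a::euclidean_space set"
  assumes subspace_E: "subspace E" and openin_M: "openin (top_of_set E) M"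
begin

lemma onb_props: "finite (onb E) \<and> onb E \<subseteq> E \<and> (\<forall>w\<in>E. (\<Sum>b\<in>onb E. (w \<bullet> b) *\<^sub>R b) = w)"
proof -
  obtain B where "B \<subseteq> E" "pairwise orthogonal B" "\<And>x. x \<in> B \<Longrightarrow> norm x = 1"
    "independent B" "span B = E"
    using orthonormal_basis_subspace[OF subspace_E] by metis
  then have "finite B \<and> B \<subseteq> E \<and> (\<forall>w\<in>E. (\<Sum>b\<in>B. (w \<bullet> b) *\<^sub>R b) = w)"
    using orthonormal_basis_expand independent_imp_finite by blast
  then show ?thesis
    unfolding onb_def by (rule someI)
qed

lemma onb_in: "b \<in> onb E \<Longrightarrow> b \<in> E"
  using onb_props by blast

lemma onb_expand: "w \<in> E \<Longrightarrow> (\<Sum>b\<in>onb E. (w \<bullet> b) *\<^sub>R b) = w"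
  using onb_props by blast

text \<open>\<open>Ck_on\<close> controls derivatives in fixed directions only. This expansion turns
  a direction that varies with the point into a finite sum over fixed directions with scalar
  coefficients.\<close>

lemma linear_onb_expand:
  assumes "linear L" "w \<in> E"
  shows "L w = (\<Sum>b\<in>onb E. (w \<bullet> b) *\<^sub>R L b)"
proof -
  have "L w = L (\<Sum>b\<in>onb E. (w \<bullet> b) *\<^sub>R b)"
    using assms(2) onb_expand by simp
  then show ?thesis
    by (simp only: linear_sum[OF assms(1)] linear_scale[OF assms(1)])
qed

lemma M_subset: "M \<subseteq> E"
  using openin_M openin_imp_subset by blast

lemma in_M_near:
  assumes "x \<in> M"
  obtains r where "r > 0" "\<And>y. \<lbrakk>y \<in> E; dist y x < r\<rbrakk> \<Longrightarrow> y \<in> M"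
  using openin_M assms that unfolding openin_euclidean_subtopology_iff by metis

sublocale feasible_domain E M
proof
  fix x v and e :: real
  assume x: "x \<in> M" and v: "v \<in> E" and e: "e > 0"
  obtain r where r: "r > 0" "\<And>y. \<lbrakk>y \<in> E; dist y x < r\<rbrakk> \<Longrightarrow> y \<in> M"
    using in_M_near[OF x] by metis
  \<comment> \<open>The second bound keeps \<open>d v\<close> shorter than \<open>r\<close>; adding
    1 to \<open>norm v\<close> avoids division by zero, and the factors 2 make the inequalities
    strict.\<close>
  define d where "d = min (e / 2) (r / (2 * (norm v + 1)))"
  have d: "0 < d" "d < e" "d * (norm v + 1) < r"
  proof -
    have nv: "0 < norm v + 1"
      by (simp add: add_nonneg_pos)
    then show "0 < d" "d < e"
      using e r(1) by (auto simp: d_def min_less_iff_disj)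
    have "d * (norm v + 1) \<le> r / (2 * (norm v + 1)) * (norm v + 1)"
      using nv by (intro mult_right_mono) (auto simp: d_def)
    also have "\<dots> = r / 2"
      using nv by (simp add: field_simps)
    finally show "d * (norm v + 1) < r"
      using r(1) by simp
  qed
  have "norm (d *\<^sub>R v) < r"
    using d by (simp add: algebra_simps)
  then have "x + d *\<^sub>R v \<in> M"
    using x v M_subset subspace_E by (intro r(2)) (auto simp: subspace_add subspace_scale dist_norm)
  then show "\<exists>d::real. 0 < \<bar>d\<bar> \<and> \<bar>d\<bar> < e \<and> x + d *\<^sub>R v \<in> M"
    using d by (intro exI[of _ d]) auto
qed

end

text \<open>Induction via the chain rule. The inner derivative is a direction in \<open>E2\<close>
  that varies with \<open>x\<close>, so it is expanded in \<open>onb E2\<close>. The source is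
  merely feasible, which admits curves on closed intervals.\<close>

lemma Ck_on_compose:
  assumes "feasible_domain E1 M1" "rel_open E2 M2" and g: "Ck_on k E1 M1 g" "g ` M1 \<subseteq> M2"
    and f: "Ck_on k E2 M2 f"
  shows "Ck_on k E1 M1 (\<lambda>x. f (g x))"
proof -
  interpret D1: feasible_domain E1 M1 by fact
  interpret D2: rel_open E2 M2 by fact
  show ?thesis
    using g f
  proof (induction k arbitrary: f)
    case 0
    then show ?case
      by (simp add: continuous_on_compose2[of M2 f M1 g])
  next
    case (Suc k)
    have lin: "linear (dird M2 f y)" if "y \<in> M2" for y
      using Ck_on_has_derivative[OF Suc.prems(3) that] has_derivative_linear by blast
    have dg: "dird M1 g x v \<in> E2" if "x \<in> M1" "v \<in> E1" for x v
      using D1.has_derivative_in_subspace[OF Ck_on_has_derivative[OF Suc.prems(1)]]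
        D2.M_subset D2.subspace_E Suc.prems(2) that by blast
    show ?case
    proof (rule D1.Ck_on_SucI)
      show "((\<lambda>x. f (g x)) has_derivative (\<lambda>v. dird M2 f (g x) (dird M1 g x v))) (at x within M1)"
        if "x \<in> M1" for x
        by (rule has_derivative_compose_within[OF Ck_on_has_derivative[OF Suc.prems(1) that]
              Ck_on_has_derivative[OF Suc.prems(3)] Suc.prems(2)]) (use Suc.prems(2) that in blast)
      show "Ck_on k E1 M1 (\<lambda>x. dird M2 f (g x) (dird M1 g x v))" if v: "v \<in> E1" for v
      proof -
        have "Ck_on k E1 M1 (\<lambda>x. \<Sum>b\<in>onb E2. (dird M1 g x v \<bullet> b) *\<^sub>R dird M2 f (g x) b)"
          by (intro D1.Ck_on_sum D1.Ck_on_bounded_bilinear[OF bounded_bilinear_scaleR]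
              D1.Ck_on_bounded_linear[OF bounded_linear_inner_left, OF Ck_on_dird[OF Suc.prems(1) v]]
              Suc.IH[OF Ck_on_Suc_imp[OF Suc.prems(1)] Suc.prems(2)] Ck_on_dird[OF Suc.prems(3)] D2.onb_in)
        moreover have "dird M2 f (g x) (dird M1 g x v)
            = (\<Sum>b\<in>onb E2. (dird M1 g x v \<bullet> b) *\<^sub>R dird M2 f (g x) b)" if "x \<in> M1" for x
          using Suc.prems(2) that by (intro D2.linear_onb_expand lin dg v) auto
        ultimately show ?thesis
          by (simp cong: Ck_on_cong)
      qed
    qed
  qed
qed

lemma smooth_on_compose:
  assumes "feasible_domain E1 M1" "rel_open E2 M2" "smooth_on E1 M1 g" "g ` M1 \<subseteq> M2"
    "smooth_on E2 M2 f"
  shows "smooth_on E1 M1 (\<lambda>x. f (g x))"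
  using Ck_on_compose[OF assms(1,2) _ assms(4)] assms(3,5) unfolding smooth_on_def by blast

context rel_open
begin

lemma smooth_on_dird_field:
  assumes f: "smooth_on E M f" and X: "smooth_on E M X" "X ` M \<subseteq> E"
  shows "smooth_on E M (\<lambda>x. dird M f x (X x))"
proof -
  have "smooth_on E M (\<lambda>x. \<Sum>b\<in>onb E. (X x \<bullet> b) *\<^sub>R dird M f x b)"
    by (intro smooth_on_sum smooth_on_bounded_bilinear[OF bounded_bilinear_scaleR]
        smooth_on_bounded_linear[OF bounded_linear_inner_left] X smooth_on_dird[OF f] onb_in)
  moreover have "dird M f x (X x) = (\<Sum>b\<in>onb E. (X x \<bullet> b) *\<^sub>R dird M f x b)" if "x \<in> M" for x
    using X(2) that by (intro linear_onb_expand linear_dird[OF f]) auto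
  ultimately show ?thesis
    by (simp cong: smooth_on_cong)
qed

end

section \<open>Symmetry of second derivatives\<close>

context rel_open
begin

text \<open>The second difference of g over a small parallelogram is, up to the factor h squared, a value
  of either mixed second derivative; letting the parallelogram shrink gives their equality.\<close>

lemma second_difference:
  fixes g :: "'a \<Rightarrow> real"
  assumes g: "smooth_on E M g" and u: "u \<in> E" and v: "v \<in> E" and h: "h > 0"
    and M: "\<And>s t. \<lbrakk>0 \<le> s; s \<le> h; 0 \<le> t; t \<le> h\<rbrakk> \<Longrightarrow> x + s *\<^sub>R u + t *\<^sub>R v \<in> M"
  shows "\<exists>s\<in>{0<..<h}. \<exists>t\<in>{0<..<h}.
    g (x + h *\<^sub>R u + h *\<^sub>R v) - g (x + h *\<^sub>R u) - g (x + h *\<^sub>R v) + g x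
      = h * h * dird M (\<lambda>y. dird M g y u) (x + s *\<^sub>R u + t *\<^sub>R v) v"
proof -
  have M0: "x + s *\<^sub>R u \<in> M" if "0 \<le> s" "s \<le> h" for s
    using M[of s 0] that h by simp
  have lin: "linear (dird M f y)" if "smooth_on E M f" "y \<in> M" for f :: "'a \<Rightarrow> real" and y
    using linear_dird that by blast
  let ?\<phi> = "\<lambda>s. g (x + s *\<^sub>R u + h *\<^sub>R v) - g (x + s *\<^sub>R u)"
  have "\<exists>s\<in>{0<..<h}. ?\<phi> h - ?\<phi> 0
      = (\<lambda>s d. dird M g (x + s *\<^sub>R u + h *\<^sub>R v) (d *\<^sub>R u) - dird M g (x + s *\<^sub>R u) (d *\<^sub>R u)) s (h - 0)"
  proof (rule mvt_simple[OF h])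
    fix s assume s: "0 \<le> s" "s \<le> h"
    have 1: "((\<lambda>s. g (x + s *\<^sub>R u + h *\<^sub>R v)) has_derivative (\<lambda>d. dird M g (x + s *\<^sub>R u + h *\<^sub>R v) (d *\<^sub>R u)))
        (at s within {0..h})"
      by (rule has_derivative_compose_within[OF _ smooth_on_has_derivative[OF g]])
        (use M s h in \<open>auto intro!: derivative_eq_intros\<close>)
    have 2: "((\<lambda>s. g (x + s *\<^sub>R u)) has_derivative (\<lambda>d. dird M g (x + s *\<^sub>R u) (d *\<^sub>R u)))
        (at s within {0..h})"
      by (rule has_derivative_compose_within[OF _ smooth_on_has_derivative[OF g]])
        (use M0 s h in \<open>auto intro!: derivative_eq_intros\<close>)
    show "(?\<phi> has_derivative (\<lambda>d. dird M g (x + s *\<^sub>R u + h *\<^sub>R v) (d *\<^sub>R u)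
        - dird M g (x + s *\<^sub>R u) (d *\<^sub>R u))) (at s within {0..h})"
      by (rule has_derivative_diff[OF 1 2])
  qed
  then obtain s where s: "0 < s" "s < h"
    and \<phi>: "?\<phi> h - ?\<phi> 0 = h * (dird M g (x + s *\<^sub>R u + h *\<^sub>R v) u - dird M g (x + s *\<^sub>R u) u)"
    using linear_scale[OF lin[OF g M], of _ h h u] linear_scale[OF lin[OF g M0], of _ h u] h
    by (auto simp: right_diff_distrib)
  let ?\<chi> = "\<lambda>t. dird M g (x + s *\<^sub>R u + t *\<^sub>R v) u"
  have "\<exists>t\<in>{0<..<h}. ?\<chi> h - ?\<chi> 0
      = (\<lambda>t d. dird M (\<lambda>y. dird M g y u) (x + s *\<^sub>R u + t *\<^sub>R v) (d *\<^sub>R v)) t (h - 0)"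
  proof (rule mvt_simple[OF h])
    fix t assume t: "0 \<le> t" "t \<le> h"
    show "(?\<chi> has_derivative (\<lambda>d. dird M (\<lambda>y. dird M g y u) (x + s *\<^sub>R u + t *\<^sub>R v) (d *\<^sub>R v)))
        (at t within {0..h})"
      by (rule has_derivative_compose_within[OF _ smooth_on_has_derivative[OF smooth_on_dird[OF g u]]])
        (use M s t in \<open>auto intro!: derivative_eq_intros\<close>)
  qed
  then obtain t where t: "0 < t" "t < h"
    and \<chi>: "?\<chi> h - ?\<chi> 0 = h * dird M (\<lambda>y. dird M g y u) (x + s *\<^sub>R u + t *\<^sub>R v) v"
    using linear_scale[OF lin[OF smooth_on_dird[OF g u] M], of s _ h v] s by auto
  show ?thesis
    using s t \<phi> \<chi> by (intro bexI[of _ s] bexI[of _ t]) (auto simp: algebra_simps)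
qed

lemma dird_commute_real:
  fixes g :: "'a \<Rightarrow> real"
  assumes g: "smooth_on E M g" and x: "x \<in> M" and u: "u \<in> E" and v: "v \<in> E"
  shows "dird M (\<lambda>y. dird M g y u) x v = dird M (\<lambda>y. dird M g y v) x u"
    (is "?F u v x = ?F v u x")
proof (rule ccontr)
  assume "?F u v x \<noteq> ?F v u x"
  \<comment> \<open>Half of the assumed gap: a common value cannot be closer than this to both
    ends.\<close>
  define e where "e = \<bar>?F u v x - ?F v u x\<bar> / 2"
  have e: "e > 0"
    using \<open>?F u v x \<noteq> ?F v u x\<close> by (simp add: e_def)
  have cont: "continuous_on M (?F a b)" if "a \<in> E" "b \<in> E" for a b
    using smooth_on_dird[OF smooth_on_dird[OF g that(1)] that(2)]
    unfolding smooth_on_def by (metis Ck_on.simps(1))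
  obtain d1 where d1: "d1 > 0" "\<And>y. \<lbrakk>y \<in> M; dist y x < d1\<rbrakk> \<Longrightarrow> dist (?F u v y) (?F u v x) < e"
    using cont[OF u v] x e unfolding continuous_on_iff by metis
  obtain d2 where d2: "d2 > 0" "\<And>y. \<lbrakk>y \<in> M; dist y x < d2\<rbrakk> \<Longrightarrow> dist (?F v u y) (?F v u x) < e"
    using cont[OF v u] x e unfolding continuous_on_iff by metis
  obtain r where r: "r > 0" "\<And>y. \<lbrakk>y \<in> E; dist y x < r\<rbrakk> \<Longrightarrow> y \<in> M"
    using in_M_near[OF x] by metis
  define d where "d = min r (min d1 d2)"
  \<comment> \<open>With this side length every point of the parallelogram lies within
    \<open>d\<close> of \<open>x\<close>, also when \<open>u\<close> or \<open>v\<close> is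
    zero.\<close>
  define h where "h = d / (norm u + norm v + 1)"
  have d: "d > 0" "d \<le> r" "d \<le> d1" "d \<le> d2"
    using d1 d2 r by (auto simp: d_def)
  have pos: "norm u + norm v + 1 > 0"
    by (simp add: add_nonneg_pos)
  then have h: "h > 0"
    using d by (simp add: h_def)
  have near: "dist (x + s *\<^sub>R u + t *\<^sub>R v) x < d" if "0 \<le> s" "s \<le> h" "0 \<le> t" "t \<le> h" for s t
  proof -
    have "dist (x + s *\<^sub>R u + t *\<^sub>R v) x = norm (s *\<^sub>R u + t *\<^sub>R v)"
      by (simp add: dist_norm)
    also have "\<dots> \<le> s * norm u + t * norm v"
      using norm_triangle_ineq[of "s *\<^sub>R u" "t *\<^sub>R v"] that by simp
    also have "\<dots> \<le> h * norm u + h * norm v"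
      using that by (intro add_mono mult_right_mono) auto
    also have "\<dots> < h * (norm u + norm v + 1)"
      using h by (simp add: algebra_simps)
    also have "\<dots> = d"
      using pos by (simp add: h_def)
    finally show ?thesis .
  qed
  have M: "x + s *\<^sub>R u + t *\<^sub>R v \<in> M" if "0 \<le> s" "s \<le> h" "0 \<le> t" "t \<le> h" for s t
    using near[OF that] d x u v M_subset subspace_E
    by (intro r(2)) (auto simp: subspace_add subspace_scale)
  have M': "x + t *\<^sub>R v + s *\<^sub>R u \<in> M" if "0 \<le> t" "t \<le> h" "0 \<le> s" "s \<le> h" for s t
    using M[of s t] that by (simp add: ac_simps)
  obtain s t where st: "0 < s" "s < h" "0 < t" "t < h"
    "g (x + h *\<^sub>R u + h *\<^sub>R v) - g (x + h *\<^sub>R u) - g (x + h *\<^sub>R v) + g x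
      = h * h * ?F u v (x + s *\<^sub>R u + t *\<^sub>R v)"
    using second_difference[OF g u v h M] by auto
  obtain t' s' where st': "0 < s'" "s' < h" "0 < t'" "t' < h"
    "g (x + h *\<^sub>R v + h *\<^sub>R u) - g (x + h *\<^sub>R v) - g (x + h *\<^sub>R u) + g x
      = h * h * ?F v u (x + t' *\<^sub>R v + s' *\<^sub>R u)"
    using second_difference[OF g v u h M'] by auto
  have "h * h * ?F u v (x + s *\<^sub>R u + t *\<^sub>R v) = h * h * ?F v u (x + s' *\<^sub>R u + t' *\<^sub>R v)"
    using st(5) st'(5)
    unfolding add.commute[of "h *\<^sub>R v" "h *\<^sub>R u"] add.commute[of "t' *\<^sub>R v" "s' *\<^sub>R u"] add.assoc
    by linarith
  then have "?F u v (x + s *\<^sub>R u + t *\<^sub>R v) = ?F v u (x + s' *\<^sub>R u + t' *\<^sub>R v)"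
    using h by simp
  moreover have "dist (?F u v (x + s *\<^sub>R u + t *\<^sub>R v)) (?F u v x) < e"
    using near[of s t] M[of s t] st d by (intro d1(2)) auto
  moreover have "dist (?F v u (x + s' *\<^sub>R u + t' *\<^sub>R v)) (?F v u x) < e"
    using near[of s' t'] M[of s' t'] st' d by (intro d2(2)) auto
  ultimately have "dist (?F u v x) (?F v u x) < \<bar>?F u v x - ?F v u x\<bar>"
    unfolding e_def by (metis dist_triangle_half_r)
  then show False
    by (simp add: dist_real_def)
qed

text \<open>The mean value argument needs real values, so the claim is checked on each component
  \<open>g \<bullet> b\<close>.\<close>

lemma dird_commute:
  fixes g :: "'a \<Rightarrow> 'b::euclidean_space"
  assumes g: "smooth_on E M g" and x: "x \<in> M" and u: "u \<in> E" and v: "v \<in> E"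
  shows "dird M (\<lambda>y. dird M g y u) x v = dird M (\<lambda>y. dird M g y v) x u"
proof (rule euclidean_eqI)
  fix b :: 'b
  have inner: "dird M (\<lambda>y. dird M g y p) x q \<bullet> b = dird M (\<lambda>y. dird M (\<lambda>y. g y \<bullet> b) y p) x q"
    if "p \<in> E" "q \<in> E" for p q
  proof -
    have "dird M (\<lambda>y. dird M g y p) x q \<bullet> b = dird M (\<lambda>y. dird M g y p \<bullet> b) x q"
      using dird_bounded_linear[OF bounded_linear_inner_left smooth_on_dird[OF g that(1)] x that(2)]
      by simp
    moreover have "dird M (\<lambda>y. dird M g y p \<bullet> b) x = dird M (\<lambda>y. dird M (\<lambda>y. g y \<bullet> b) y p) x"
      by (rule dird_transform[OF _ x])
        (use dird_bounded_linear[OF bounded_linear_inner_left g _ that(1)] in simp)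
    ultimately show ?thesis
      by simp
  qed
  show "dird M (\<lambda>y. dird M g y u) x v \<bullet> b = dird M (\<lambda>y. dird M g y v) x u \<bullet> b"
    using dird_commute_real[OF smooth_on_bounded_linear[OF bounded_linear_inner_left g] x u v]
    by (simp add: inner u v)
qed

text \<open>Expanding \<open>Y\<close> in \<open>onb E\<close>, the product rule yields a Hessian
  term and a first-order term. Symmetry of second derivatives moves \<open>u\<close> inside the
  Hessian, the form in which curvature terms can be compared.\<close>

lemma dird_dird_field:
  assumes g: "smooth_on E M g" and Y: "smooth_on E M Y" "Y ` M \<subseteq> E" and x: "x \<in> M" and u: "u \<in> E"
  shows "dird M (\<lambda>y. dird M g y (Y y)) x u
    = dird M (\<lambda>y. dird M g y u) x (Y x) + dird M g x (dird M Y x u)"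
proof -
  have YE: "Y y \<in> E" if "y \<in> M" for y
    using Y(2) that by blast
  have Yb: "smooth_on E M (\<lambda>y. Y y \<bullet> b)" for b
    by (intro smooth_on_bounded_linear[OF bounded_linear_inner_left] Y)
  have dg: "smooth_on E M (\<lambda>y. dird M g y b)" if "b \<in> onb E" for b
    by (intro smooth_on_dird g onb_in that)
  have "dird M (\<lambda>y. dird M g y (Y y)) x = dird M (\<lambda>y. \<Sum>b\<in>onb E. (Y y \<bullet> b) *\<^sub>R dird M g y b) x"
    by (rule dird_transform[OF linear_onb_expand[OF linear_dird[OF g]] x]) (use YE in auto)
  then have "dird M (\<lambda>y. dird M g y (Y y)) x u
      = (\<Sum>b\<in>onb E. dird M (\<lambda>y. (Y y \<bullet> b) *\<^sub>R dird M g y b) x u)"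
    using dird_sum[OF smooth_on_bounded_bilinear[OF bounded_bilinear_scaleR Yb dg] x u] by simp
  also have "\<dots> = (\<Sum>b\<in>onb E. (Y x \<bullet> b) *\<^sub>R dird M (\<lambda>y. dird M g y u) x b
      + (dird M Y x u \<bullet> b) *\<^sub>R dird M g x b)"
    using dird_bounded_bilinear[OF bounded_bilinear_scaleR Yb dg x u]
      dird_bounded_linear[OF bounded_linear_inner_left Y(1) x u] dird_commute[OF g x onb_in u]
    by (intro sum.cong) auto
  also have "\<dots> = dird M (\<lambda>y. dird M g y u) x (Y x) + dird M g x (dird M Y x u)"
    unfolding sum.distrib
    using linear_onb_expand[OF linear_dird[OF smooth_on_dird[OF g u] x] YE[OF x]]
      linear_onb_expand[OF linear_dird[OF g x] dird_in_subspace[OF Y(1) subspace_E Y(2) x u]]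
    by simp
  finally show ?thesis .
qed

end

lemma dird_compose:
  assumes "feasible_domain E1 M1" "feasible_domain E2 M2" "smooth_on E1 M1 g" "g ` M1 \<subseteq> M2"
    "smooth_on E2 M2 f" "x \<in> M1" "v \<in> E1"
  shows "dird M1 (\<lambda>x. f (g x)) x v = dird M2 f (g x) (dird M1 g x v)"
  by (rule feasible_domain.dird_eq[OF assms(1) has_derivative_compose_within[where T=M2]
        assms(6,7)])
    (use assms smooth_on_has_derivative in blast)+

section \<open>Vector fields and affine connections\<close>

context rel_open
begin

lemma vector_fieldsD:
  assumes "X \<in> vector_fields E M"
  shows "smooth_on E M X" "X ` M \<subseteq> E" "x \<in> M \<Longrightarrow> X x \<in> E" "x \<notin> M \<Longrightarrow> X x = 0"
  using assms by (auto simp: vector_fields_def)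

lemma vector_fields_extend:
  assumes "smooth_on E M f" "\<And>x. x \<in> M \<Longrightarrow> f x \<in> E"
  shows "(\<lambda>x. if x \<in> M then f x else 0) \<in> vector_fields E M"
  using assms by (auto simp: vector_fields_def cong: smooth_on_cong)

lemma zero_vector_field: "(\<lambda>x. 0) \<in> vector_fields E M"
  using subspace_E by (auto simp: vector_fields_def subspace_0 smooth_on_const)

lemma vector_fields_add:
  "\<lbrakk>X \<in> vector_fields E M; Y \<in> vector_fields E M\<rbrakk> \<Longrightarrow> (\<lambda>x. X x + Y x) \<in> vector_fields E M"
  using subspace_E by (auto simp: vector_fields_def subspace_add smooth_on_add)

lemma vector_fields_scale:
  "\<lbrakk>smooth_on E M f; X \<in> vector_fields E M\<rbrakk> \<Longrightarrow> (\<lambda>x. f x *\<^sub>R X x) \<in> vector_fields E M"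
  using subspace_E
  by (auto simp: vector_fields_def subspace_scale smooth_on_bounded_bilinear[OF bounded_bilinear_scaleR])

lemma vector_fields_sum:
  "(\<And>b. b \<in> B \<Longrightarrow> X b \<in> vector_fields E M) \<Longrightarrow> (\<lambda>x. \<Sum>b\<in>B. X b x) \<in> vector_fields E M"
  by (induction B rule: infinite_finite_induct) (auto intro: zero_vector_field vector_fields_add)

lemma const_field_in: "v \<in> E \<Longrightarrow> const_field M v \<in> vector_fields E M"
  unfolding const_field_def by (rule vector_fields_extend[OF smooth_on_const])

lemma lie_bracket_in:
  assumes "X \<in> vector_fields E M" "Y \<in> vector_fields E M"
  shows "lie_bracket M X Y \<in> vector_fields E M"
  unfolding lie_bracket_def
  by (intro vector_fields_extend smooth_on_diff smooth_on_dird_field subspace_diff subspace_E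
      dird_in_subspace vector_fieldsD[OF assms(1)] vector_fieldsD[OF assms(2)])

lemma vector_field_expand:
  assumes "X \<in> vector_fields E M"
  shows "X = (\<lambda>x. \<Sum>b\<in>onb E. (X x \<bullet> b) *\<^sub>R const_field M b x)"
proof
  fix x
  show "X x = (\<Sum>b\<in>onb E. (X x \<bullet> b) *\<^sub>R const_field M b x)"
    using onb_expand[of "X x"] vector_fieldsD[OF assms] by (cases "x \<in> M") (auto simp: const_field_def)
qed

end

locale affine_conn = rel_open E M for E M :: "'a::euclidean_space set" +
  fixes D :: "'a conn"
  assumes affine: "affine_connection E M D"
begin

lemma conn_in: "\<lbrakk>X \<in> vector_fields E M; Y \<in> vector_fields E M\<rbrakk> \<Longrightarrow> D X Y \<in> vector_fields E M"
  using affine unfolding affine_connection_def by blast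

lemma conn_add_left:
  "\<lbrakk>X \<in> vector_fields E M; X' \<in> vector_fields E M; Y \<in> vector_fields E M\<rbrakk>
    \<Longrightarrow> D (\<lambda>x. X x + X' x) Y = (\<lambda>x. D X Y x + D X' Y x)"
  using affine unfolding affine_connection_def by blast

lemma conn_scale_left:
  "\<lbrakk>smooth_on E M f; X \<in> vector_fields E M; Y \<in> vector_fields E M\<rbrakk>
    \<Longrightarrow> D (\<lambda>x. f x *\<^sub>R X x) Y = (\<lambda>x. f x *\<^sub>R D X Y x)"
  using affine unfolding affine_connection_def by blast

lemma conn_add_right:
  "\<lbrakk>X \<in> vector_fields E M; Y \<in> vector_fields E M; Y' \<in> vector_fields E M\<rbrakk>
    \<Longrightarrow> D X (\<lambda>x. Y x + Y' x) = (\<lambda>x. D X Y x + D X Y' x)"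
  using affine unfolding affine_connection_def by blast

lemma conn_leibniz:
  "\<lbrakk>smooth_on E M f; X \<in> vector_fields E M; Y \<in> vector_fields E M\<rbrakk>
    \<Longrightarrow> D X (\<lambda>x. f x *\<^sub>R Y x) = (\<lambda>x. dird M f x (X x) *\<^sub>R Y x + f x *\<^sub>R D X Y x)"
  using affine unfolding affine_connection_def by blast

lemma conn_not_in: "X \<notin> vector_fields E M \<or> Y \<notin> vector_fields E M \<Longrightarrow> D X Y = (\<lambda>x. 0)"
  using affine unfolding affine_connection_def by blast

lemma conn_zero_left: "D (\<lambda>x. 0) Y = (\<lambda>x. 0)"
proof (cases "Y \<in> vector_fields E M")
  case True
  then show ?thesis
    using conn_scale_left[OF smooth_on_const zero_vector_field, of Y 0] by simp
qed (simp add: conn_not_in)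

lemma conn_zero_right: "D X (\<lambda>x. 0) = (\<lambda>x. 0)"
proof (cases "X \<in> vector_fields E M")
  case True
  have "D X (\<lambda>x. 0 *\<^sub>R (0::'a)) x = 0" for x
    using fun_cong[OF conn_leibniz[OF smooth_on_const True zero_vector_field, of 0], of x] by simp
  then show ?thesis
    by auto
qed (simp add: conn_not_in)

lemma conn_sum_left:
  assumes "\<And>b. b \<in> B \<Longrightarrow> smooth_on E M (f b)" "\<And>b. b \<in> B \<Longrightarrow> X b \<in> vector_fields E M"
    and "Y \<in> vector_fields E M"
  shows "D (\<lambda>x. \<Sum>b\<in>B. f b x *\<^sub>R X b x) Y = (\<lambda>x. \<Sum>b\<in>B. f b x *\<^sub>R D (X b) Y x)"
  using assms
proof (induction B rule: infinite_finite_induct)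
  case (insert b B)
  then have "D (\<lambda>x. f b x *\<^sub>R X b x + (\<Sum>b\<in>B. f b x *\<^sub>R X b x)) Y
    = (\<lambda>x. D (\<lambda>x. f b x *\<^sub>R X b x) Y x + D (\<lambda>x. \<Sum>b\<in>B. f b x *\<^sub>R X b x) Y x)"
    by (intro conn_add_left vector_fields_scale vector_fields_sum) auto
  then show ?case
    using insert by (simp add: conn_scale_left)
qed (auto simp: conn_zero_left)

lemma conn_sum_right:
  assumes "\<And>b. b \<in> B \<Longrightarrow> smooth_on E M (f b)" "\<And>b. b \<in> B \<Longrightarrow> Y b \<in> vector_fields E M"
    and "X \<in> vector_fields E M"
  shows "D X (\<lambda>x. \<Sum>b\<in>B. f b x *\<^sub>R Y b x)
    = (\<lambda>x. \<Sum>b\<in>B. dird M (f b) x (X x) *\<^sub>R Y b x + f b x *\<^sub>R D X (Y b) x)"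
  using assms
proof (induction B rule: infinite_finite_induct)
  case (insert b B)
  then have "D X (\<lambda>x. f b x *\<^sub>R Y b x + (\<Sum>b\<in>B. f b x *\<^sub>R Y b x))
    = (\<lambda>x. D X (\<lambda>x. f b x *\<^sub>R Y b x) x + D X (\<lambda>x. \<Sum>b\<in>B. f b x *\<^sub>R Y b x) x)"
    by (intro conn_add_right vector_fields_scale vector_fields_sum) auto
  then show ?case
    using insert by (simp add: conn_leibniz)
qed (auto simp: conn_zero_right)

text \<open>Tensoriality in the first argument: expanding \<open>X\<close> in constant fields pulls
  the coefficients out of the connection, so only the value of \<open>X\<close> at \<open>x\<close>
  survives. Comparison with the constant field of that value gives the Christoffel form.\<close>

lemma conn_const_field:
  assumes X: "X \<in> vector_fields E M" and w: "w \<in> E" and x: "x \<in> M"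
  shows "D X (const_field M w) x = christoffel M D x (X x) w"
proof -
  have *: "D X (const_field M w) x = (\<Sum>b\<in>onb E. (X x \<bullet> b) *\<^sub>R christoffel M D x b w)"
    if X: "X \<in> vector_fields E M" for X
  proof -
    have "D X (const_field M w)
        = D (\<lambda>x. \<Sum>b\<in>onb E. (X x \<bullet> b) *\<^sub>R const_field M b x) (const_field M w)"
      using vector_field_expand[OF X] by simp
    also have "\<dots> = (\<lambda>x. \<Sum>b\<in>onb E. (X x \<bullet> b) *\<^sub>R D (const_field M b) (const_field M w) x)"
      by (intro conn_sum_left smooth_on_bounded_linear[OF bounded_linear_inner_left]
          vector_fieldsD(1)[OF X] const_field_in w onb_in)
    finally show ?thesis
      by (simp add: christoffel_def)
  qed
  have "X x \<in> E"
    using vector_fieldsD(3)[OF X x] .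
  then have "christoffel M D x (X x) w = (\<Sum>b\<in>onb E. (X x \<bullet> b) *\<^sub>R christoffel M D x b w)"
    using *[OF const_field_in, of "X x"] x by (simp add: christoffel_def const_field_def)
  then show ?thesis
    using *[OF X] by simp
qed

text \<open>Leibniz rule on the expansion of \<open>Y\<close> in constant fields. This links the
  abstract connection to \<open>christoffel\<close>, in terms of which covariant derivatives along
  curves are defined.\<close>

lemma conn_eq_christoffel:
  assumes X: "X \<in> vector_fields E M" and Y: "Y \<in> vector_fields E M" and x: "x \<in> M"
  shows "D X Y x = dird M Y x (X x) + christoffel M D x (X x) (Y x)"
proof -
  have cx: "const_field M b x = b" for b
    using x by (simp add: const_field_def)
  have *: "D X Y x = (\<Sum>b\<in>onb E. (dird M Y x (X x) \<bullet> b) *\<^sub>R b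
      + (Y x \<bullet> b) *\<^sub>R christoffel M D x (X x) b)"
    if X: "X \<in> vector_fields E M" and Y: "Y \<in> vector_fields E M" for X Y
  proof -
    have "D X Y = D X (\<lambda>x. \<Sum>b\<in>onb E. (Y x \<bullet> b) *\<^sub>R const_field M b x)"
      using vector_field_expand[OF Y] by simp
    also have "\<dots> = (\<lambda>x. \<Sum>b\<in>onb E. dird M (\<lambda>x. Y x \<bullet> b) x (X x) *\<^sub>R const_field M b x
        + (Y x \<bullet> b) *\<^sub>R D X (const_field M b) x)"
      by (intro conn_sum_right smooth_on_bounded_linear[OF bounded_linear_inner_left]
          vector_fieldsD(1)[OF Y] const_field_in X onb_in)
    finally show ?thesis
      by (simp add: conn_const_field[OF X onb_in x] cx
          dird_bounded_linear[OF bounded_linear_inner_left vector_fieldsD(1)[OF Y] x vector_fieldsD(3)[OF X x]])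
  qed
  have Yx: "Y x \<in> E" and Xx: "X x \<in> E"
    using vector_fieldsD(3)[OF X x] vector_fieldsD(3)[OF Y x] by auto
  \<comment> \<open>The formula is used a second time, for the constant field of value
    \<open>Y x\<close>; as its derivative vanishes, what remains expands \<open>christoffel\<close>
    in the last argument.\<close>
  have "dird M (const_field M (Y x)) x (X x) = 0"
    using dird_transform[OF _ x, of "const_field M (Y x)" "\<lambda>_. Y x"] dird_const[OF x Xx]
    by (simp add: const_field_def)
  then have "christoffel M D x (X x) (Y x) = (\<Sum>b\<in>onb E. (Y x \<bullet> b) *\<^sub>R christoffel M D x (X x) b)"
    using *[OF const_field_in[OF Xx] const_field_in[OF Yx]] x
    by (simp add: christoffel_def const_field_def)
  then show ?thesis
    using *[OF X Y] onb_expand[of "dird M Y x (X x)"] vector_fieldsD[OF Y] Xx subspace_E x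
    by (simp add: sum.distrib dird_in_subspace)
qed

end

section \<open>Geodesics\<close>

text \<open>Every point of a nondegenerate interval, an endpoint included, is joined within it to a
  second point \<open>z\<close>. If \<open>v\<close> points away from \<open>z\<close>, then
  \<open>d\<close> comes out negative.\<close>

lemma param_interval_feasible:
  assumes "param_interval I"
  shows "feasible_domain UNIV I"
proof
  fix t v e :: real
  assume t: "t \<in> I" and e: "e > 0"
  obtain p r where pr: "r > 0" "cball p r \<subseteq> I"
    using assms mem_interior_cball[of _ I] unfolding param_interval_def by blast
  then have "p \<in> I" "p + r \<in> I"
    by (auto simp: dist_real_def)
  then obtain z where z: "z \<in> I" "z \<noteq> t"
    using pr(1) by (metis add_cancel_left_right less_irrefl)
  show "\<exists>d. 0 < \<bar>d\<bar> \<and> \<bar>d\<bar> < e \<and> t + d *\<^sub>R v \<in> I"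
  proof (cases "v = 0")
    case True
    then show ?thesis
      using t e by (intro exI[of _ "e / 2"]) auto
  next
    case False
    \<comment> \<open>The fraction of the way towards \<open>z\<close>: at most 1 to stay on the
      segment, and small enough that the resulting \<open>d\<close> is at most \<open>e / 2\<close>
      in absolute value.\<close>
    define \<tau> where "\<tau> = min 1 (e * \<bar>v\<bar> / (2 * \<bar>z - t\<bar>))"
    have \<tau>: "0 < \<tau>" "\<tau> \<le> 1" "\<tau> * \<bar>z - t\<bar> \<le> e * \<bar>v\<bar> / 2"
    proof -
      show "0 < \<tau>" "\<tau> \<le> 1"
        using z False e by (auto simp: \<tau>_def)
      have "\<tau> * \<bar>z - t\<bar> \<le> e * \<bar>v\<bar> / (2 * \<bar>z - t\<bar>) * \<bar>z - t\<bar>"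
        by (intro mult_right_mono) (auto simp: \<tau>_def)
      then show "\<tau> * \<bar>z - t\<bar> \<le> e * \<bar>v\<bar> / 2"
        using z by simp
    qed
    have "(1 - \<tau>) *\<^sub>R t + \<tau> *\<^sub>R z \<in> I"
      using assms t z(1) \<tau> unfolding param_interval_def
      by (intro convexD[OF is_interval_convex]) auto
    then have I: "t + (\<tau> * (z - t) / v) *\<^sub>R v \<in> I"
      by (simp add: False) (simp add: algebra_simps)
    have "\<bar>\<tau> * (z - t) / v\<bar> = \<tau> * \<bar>z - t\<bar> / \<bar>v\<bar>"
      using \<tau> by (simp add: abs_mult)
    also have "\<dots> \<le> (e * \<bar>v\<bar> / 2) / \<bar>v\<bar>"
      by (intro divide_right_mono \<tau>) auto
    also have "\<dots> < e"
      using e False by simp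
    finally show ?thesis
      using I \<tau> z False by (intro exI[of _ "\<tau> * (z - t) / v"]) auto
  qed
qed

lemma param_interval_vector_derivative:
  assumes I: "param_interval I" and t: "t \<in> I" and c: "(c has_vector_derivative w) (at t within I)"
  shows "vector_derivative c (at t within I) = w"
proof (rule vector_derivative_within[OF _ c])
  have "\<exists>s\<in>I. s \<noteq> t \<and> dist s t < e" if "e > 0" for e
    using feasible_domain.feasible[OF param_interval_feasible[OF I] t UNIV_I that, of 1]
    by (auto simp: dist_real_def intro!: bexI[of _ "t + _"])
  then show "at t within I \<noteq> bot"
    unfolding trivial_limit_within islimpt_approachable by blast
qed

context rel_open
begin

text \<open>Bootstrapping: if \<open>c\<close> is of class k, then so is its derivative
  \<open>X (c t)\<close>, which puts \<open>c\<close> in class k + 1.\<close>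

lemma integral_curve_smooth:
  assumes X: "X \<in> vector_fields E M" and c: "integral_curve M X I c"
  shows "smooth_on UNIV I c"
proof -
  have I: "param_interval I" and cM: "c ` I \<subseteq> M"
    and c': "\<And>t. t \<in> I \<Longrightarrow> (c has_derivative (\<lambda>d. d *\<^sub>R X (c t))) (at t within I)"
    using c by (auto simp: integral_curve_def has_vector_derivative_def)
  interpret I: feasible_domain UNIV I
    by (rule param_interval_feasible[OF I])
  have "Ck_on k UNIV I c" for k
  proof (induction k)
    case 0
    then show ?case
      using c' by (auto intro!: continuous_on_eq_continuous_within[THEN iffD2] has_derivative_continuous)
  next
    case (Suc k)
    have "Ck_on k UNIV I (\<lambda>t. X (c t))"
      using vector_fieldsD(1)[OF X]
      by (intro Ck_on_compose[OF I.feasible_domain_axioms rel_open_axioms Suc cM]) (simp add: smooth_on_def)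
    then show ?case
      by (intro I.Ck_on_SucI[OF c'] I.Ck_on_bounded_linear[OF bounded_linear_scaleR_right])
  qed
  then show ?thesis
    by (simp add: smooth_on_def)
qed

end

context affine_conn
begin

text \<open>Differentiating \<open>c' = X (c)\<close> gives the derivative of \<open>X\<close> in
  direction \<open>X\<close>; with the Christoffel term added, the covariant acceleration is the
  value of \<open>D X X\<close> at \<open>c t\<close>.\<close>

lemma integral_curve_geodesic:
  assumes X: "X \<in> vector_fields E M" and DXX: "D X X = (\<lambda>x. 0)" and c: "integral_curve M X I c"
  shows "geodesic M D I c"
proof -
  have I: "param_interval I" and cM: "c ` I \<subseteq> M"
    and c': "\<And>t. t \<in> I \<Longrightarrow> (c has_vector_derivative X (c t)) (at t within I)"
    using c by (auto simp: integral_curve_def)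
  have vd: "vector_derivative c (at t within I) = X (c t)" if "t \<in> I" for t
    by (rule param_interval_vector_derivative[OF I that c'[OF that]])
  have "cov_deriv_along M D I c (\<lambda>s. vector_derivative c (at s within I)) t = 0" if t: "t \<in> I" for t
  proof -
    have ct: "c t \<in> M"
      using cM t by blast
    have lin: "linear (dird M X (c t))"
      by (rule linear_dird[OF vector_fieldsD(1)[OF X] ct])
    have "((\<lambda>s. X (c s)) has_derivative (\<lambda>d. dird M X (c t) (d *\<^sub>R X (c t)))) (at t within I)"
      by (rule has_derivative_compose_within[OF _ smooth_on_has_derivative[OF vector_fieldsD(1)[OF X] ct] cM])
        (use c'[OF t] in \<open>simp add: has_vector_derivative_def\<close>)
    then have "((\<lambda>s. X (c s)) has_vector_derivative dird M X (c t) (X (c t))) (at t within I)"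
      by (simp add: has_vector_derivative_def linear_scale[OF lin])
    then have "((\<lambda>s. vector_derivative c (at s within I)) has_vector_derivative dird M X (c t) (X (c t)))
        (at t within I)"
      by (rule has_vector_derivative_transform[OF t vd, rotated])
    then have "cov_deriv_along M D I c (\<lambda>s. vector_derivative c (at s within I)) t = D X X (c t)"
      using conn_eq_christoffel[OF X X ct]
      by (simp add: cov_deriv_along_def vd[OF t] param_interval_vector_derivative[OF I t])
    then show ?thesis
      by (simp add: DXX)
  qed
  then show ?thesis
    using I cM integral_curve_smooth[OF X c] by (simp add: geodesic_def)
qed

end

section \<open>Connections with a global parallel frame\<close>

text \<open>A smooth trivialisation of the tangent bundle: theta x identifies the tangent space E at x with
  the model space F, and iota x is its inverse.\<close>

locale framed = rel_open E M for E M :: "'a::euclidean_space set" +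
  fixes F :: "'a set" and \<theta> \<iota> :: "'a \<Rightarrow> 'a \<Rightarrow> 'a"
  assumes subspace_F: "subspace F"
    and linear_theta: "x \<in> M \<Longrightarrow> linear (\<theta> x)"
    and linear_iota: "x \<in> M \<Longrightarrow> linear (\<iota> x)"
    and theta_in: "\<lbrakk>x \<in> M; w \<in> E\<rbrakk> \<Longrightarrow> \<theta> x w \<in> F"
    and iota_in: "\<lbrakk>x \<in> M; A \<in> F\<rbrakk> \<Longrightarrow> \<iota> x A \<in> E"
    and iota_theta: "\<lbrakk>x \<in> M; w \<in> E\<rbrakk> \<Longrightarrow> \<iota> x (\<theta> x w) = w"
    and theta_iota: "\<lbrakk>x \<in> M; A \<in> F\<rbrakk> \<Longrightarrow> \<theta> x (\<iota> x A) = A"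
    and smooth_theta: "smooth_on E M Y \<Longrightarrow> smooth_on E M (\<lambda>x. \<theta> x (Y x))"
    and smooth_iota: "smooth_on E M g \<Longrightarrow> smooth_on E M (\<lambda>x. \<iota> x (g x))"

definition frame_conn ::
  "'a::euclidean_space set \<Rightarrow> 'a set \<Rightarrow> ('a \<Rightarrow> 'a \<Rightarrow> 'a) \<Rightarrow> ('a \<Rightarrow> 'a \<Rightarrow> 'a) \<Rightarrow> 'a conn" where
  "frame_conn E M \<theta> \<iota> X Y =
    (if X \<in> vector_fields E M \<and> Y \<in> vector_fields E M
     then (\<lambda>x. if x \<in> M then \<iota> x (dird M (\<lambda>y. \<theta> y (Y y)) x (X x)) else 0)
     else (\<lambda>x. 0))"

definition frame_field :: "'a::euclidean_space set \<Rightarrow> ('a \<Rightarrow> 'a \<Rightarrow> 'a) \<Rightarrow> 'a \<Rightarrow> 'a \<Rightarrow> 'a" where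
  "frame_field M \<iota> A = (\<lambda>x. if x \<in> M then \<iota> x A else 0)"

context framed
begin

abbreviation conn :: "'a conn" where
  "conn \<equiv> frame_conn E M \<theta> \<iota>"

lemma smooth_theta_field: "Y \<in> vector_fields E M \<Longrightarrow> smooth_on E M (\<lambda>x. \<theta> x (Y x))"
  by (intro smooth_theta vector_fieldsD)

lemma theta_field_in: "Y \<in> vector_fields E M \<Longrightarrow> (\<lambda>x. \<theta> x (Y x)) ` M \<subseteq> F"
  using theta_in vector_fieldsD(3) by blast

lemma dird_theta_field_in:
  "\<lbrakk>Y \<in> vector_fields E M; x \<in> M; v \<in> E\<rbrakk> \<Longrightarrow> dird M (\<lambda>y. \<theta> y (Y y)) x v \<in> F"
  by (intro dird_in_subspace smooth_theta_field theta_field_in subspace_F)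

lemma frame_field_in: "A \<in> F \<Longrightarrow> frame_field M \<iota> A \<in> vector_fields E M"
  unfolding frame_field_def by (intro vector_fields_extend smooth_iota smooth_on_const iota_in)

lemma conn_apply:
  "\<lbrakk>X \<in> vector_fields E M; Y \<in> vector_fields E M; x \<in> M\<rbrakk>
    \<Longrightarrow> conn X Y x = \<iota> x (dird M (\<lambda>y. \<theta> y (Y y)) x (X x))"
  by (simp add: frame_conn_def)

lemma conn_outside: "x \<notin> M \<Longrightarrow> conn X Y x = 0"
  by (simp add: frame_conn_def)

lemma frame_conn_in:
  assumes X: "X \<in> vector_fields E M" and Y: "Y \<in> vector_fields E M"
  shows "conn X Y \<in> vector_fields E M"
proof -
  have "(\<lambda>x. if x \<in> M then \<iota> x (dird M (\<lambda>y. \<theta> y (Y y)) x (X x)) else 0) \<in> vector_fields E M"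
    by (intro vector_fields_extend smooth_iota iota_in smooth_on_dird_field smooth_theta_field
        dird_theta_field_in vector_fieldsD(1,2,3)[OF X] Y)
  then show ?thesis
    using X Y by (simp add: frame_conn_def)
qed

text \<open>Each axiom is the corresponding rule for directional derivatives of the coordinates,
  moved through the linear maps \<open>\<theta> x\<close> and \<open>\<iota> x\<close>. In the
  Leibniz rule \<open>\<iota> x\<close> undoes \<open>\<theta> x\<close> on the term with the
  derivative of \<open>f\<close>.\<close>

lemma affine_frame_conn: "affine_connection E M conn"
  unfolding affine_connection_def
proof (intro conjI ballI allI impI)
  fix X X' Y assume *: "X \<in> vector_fields E M" "X' \<in> vector_fields E M" "Y \<in> vector_fields E M"
  show "conn (\<lambda>x. X x + X' x) Y = (\<lambda>x. conn X Y x + conn X' Y x)"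
  proof
    fix x show "conn (\<lambda>x. X x + X' x) Y x = conn X Y x + conn X' Y x"
      using * linear_dird[OF smooth_theta_field] linear_iota
      by (cases "x \<in> M") (auto simp: conn_outside conn_apply vector_fields_add linear_add)
  qed
next
  fix f :: "'a \<Rightarrow> real" and X Y assume *: "smooth_on E M f" "X \<in> vector_fields E M" "Y \<in> vector_fields E M"
  show "conn (\<lambda>x. f x *\<^sub>R X x) Y = (\<lambda>x. f x *\<^sub>R conn X Y x)"
  proof
    fix x show "conn (\<lambda>x. f x *\<^sub>R X x) Y x = f x *\<^sub>R conn X Y x"
      using * linear_dird[OF smooth_theta_field] linear_iota
      by (cases "x \<in> M") (auto simp: conn_outside conn_apply vector_fields_scale linear_scale)
  qed
next
  fix X Y Y' assume *: "X \<in> vector_fields E M" "Y \<in> vector_fields E M" "Y' \<in> vector_fields E M"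
  show "conn X (\<lambda>x. Y x + Y' x) = (\<lambda>x. conn X Y x + conn X Y' x)"
  proof
    fix x show "conn X (\<lambda>x. Y x + Y' x) x = conn X Y x + conn X Y' x"
    proof (cases "x \<in> M")
      case True
      have "dird M (\<lambda>y. \<theta> y (Y y + Y' y)) x = dird M (\<lambda>y. \<theta> y (Y y) + \<theta> y (Y' y)) x"
        by (rule dird_transform[OF _ True]) (simp add: linear_add linear_theta)
      then show ?thesis
        using True * dird_add[OF smooth_theta_field smooth_theta_field] vector_fieldsD(3)[OF *(1) True]
        by (simp add: conn_apply vector_fields_add linear_add linear_iota)
    qed (simp add: conn_outside)
  qed
next
  fix f :: "'a \<Rightarrow> real" and X Y assume *: "smooth_on E M f" "X \<in> vector_fields E M" "Y \<in> vector_fields E M"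
  show "conn X (\<lambda>x. f x *\<^sub>R Y x) = (\<lambda>x. dird M f x (X x) *\<^sub>R Y x + f x *\<^sub>R conn X Y x)"
  proof
    fix x show "conn X (\<lambda>x. f x *\<^sub>R Y x) x = dird M f x (X x) *\<^sub>R Y x + f x *\<^sub>R conn X Y x"
    proof (cases "x \<in> M")
      case True
      have "dird M (\<lambda>y. \<theta> y (f y *\<^sub>R Y y)) x = dird M (\<lambda>y. f y *\<^sub>R \<theta> y (Y y)) x"
        by (rule dird_transform[OF _ True]) (simp add: linear_scale linear_theta)
      then show ?thesis
        using True * vector_fieldsD(3)[OF *(2) True] vector_fieldsD(3)[OF *(3) True]
          dird_bounded_bilinear[OF bounded_bilinear_scaleR *(1) smooth_theta_field[OF *(3)] True]
        by (simp add: conn_apply vector_fields_scale linear_add linear_scale linear_iota iota_theta)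
    next
      case False
      then show ?thesis
        using vector_fieldsD(4)[OF *(3)] by (simp add: conn_outside)
    qed
  qed
qed (blast intro: frame_conn_in, auto simp: frame_conn_def)

lemma frame_field_parallel:
  assumes A: "A \<in> F"
  shows "parallel_field E M conn (frame_field M \<iota> A)"
  unfolding parallel_field_def
proof (intro ballI ext)
  fix X x assume X: "X \<in> vector_fields E M"
  show "conn X (frame_field M \<iota> A) x = 0"
  proof (cases "x \<in> M")
    case True
    have "dird M (\<lambda>y. \<theta> y (frame_field M \<iota> A y)) x = dird M (\<lambda>y. A) x"
      by (rule dird_transform[OF _ True]) (simp add: frame_field_def theta_iota A)
    then show ?thesis
      using True X A
      by (simp add: conn_apply frame_field_in dird_const vector_fieldsD linear_0 linear_iota)
  qed (simp add: conn_outside)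
qed

lemma theta_conn:
  assumes "X \<in> vector_fields E M" "Y \<in> vector_fields E M" "x \<in> M"
  shows "\<theta> x (conn X Y x) = dird M (\<lambda>y. \<theta> y (Y y)) x (X x)"
  using assms by (simp add: conn_apply theta_iota dird_theta_field_in vector_fieldsD)

lemma flat_frame_conn: "flat_connection E M conn"
  unfolding flat_connection_def
proof (intro ballI ext)
  fix X Y Z x
  assume X: "X \<in> vector_fields E M" and Y: "Y \<in> vector_fields E M" and Z: "Z \<in> vector_fields E M"
  define g where "g = (\<lambda>x. \<theta> x (Z x))"
  have g: "smooth_on E M g"
    using smooth_theta_field[OF Z] by (simp add: g_def)
  have lb: "lie_bracket M X Y \<in> vector_fields E M"
    by (rule lie_bracket_in[OF X Y])
  show "curvature M conn X Y Z x = 0"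
  proof (cases "x \<in> M")
    case x: True
    have XE: "X x \<in> E" and YE: "Y x \<in> E"
      using vector_fieldsD(3)[OF X x] vector_fieldsD(3)[OF Y x] by auto
    have dX: "dird M X x (Y x) \<in> E" and dY: "dird M Y x (X x) \<in> E"
      by (intro dird_in_subspace vector_fieldsD(1,2)[OF X] vector_fieldsD(1,2)[OF Y] subspace_E x XE YE)+
    \<comment> \<open>In coordinates a second covariant derivative splits into the Hessian of
      \<open>g\<close>, symmetric in \<open>V\<close> and \<open>W\<close>, and a term with the
      derivative of \<open>W\<close> along \<open>V\<close>. The terms of the latter kind from the
      two orders cancel against the Lie bracket.\<close>
    have DD: "conn V (conn W Z) x = \<iota> x (dird M (\<lambda>y. dird M g y (V x)) x (W x) + dird M g x (dird M W x (V x)))"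
      if V: "V \<in> vector_fields E M" and W: "W \<in> vector_fields E M" for V W
    proof -
      have "dird M (\<lambda>y. \<theta> y (conn W Z y)) x = dird M (\<lambda>y. dird M g y (W y)) x"
        by (rule dird_transform[OF _ x]) (simp add: theta_conn[OF W Z] g_def)
      then show ?thesis
        using conn_apply[OF V frame_conn_in[OF W Z] x]
          dird_dird_field[OF g vector_fieldsD(1,2)[OF W] x vector_fieldsD(3)[OF V x]]
        by simp
    qed
    have "conn (lie_bracket M X Y) Z x
        = \<iota> x (dird M g x (dird M Y x (X x)) - dird M g x (dird M X x (Y x)))"
      using conn_apply[OF lb Z x] x linear_diff[OF linear_dird[OF g x]]
      by (simp add: g_def lie_bracket_def)
    moreover have "dird M (\<lambda>y. dird M g y (X x)) x (Y x) = dird M (\<lambda>y. dird M g y (Y x)) x (X x)"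
      by (rule dird_commute[OF g x XE YE])
    ultimately show ?thesis
      by (simp add: curvature_def DD[OF X Y] DD[OF Y X] linear_add[OF linear_iota[OF x]]
          linear_diff[OF linear_iota[OF x]])
  qed (simp add: curvature_def conn_outside)
qed

text \<open>When \<open>Y\<close> is expanded in the frame fields, parallelism leaves only the
  derivatives of the coefficients in the Leibniz rule, and these are what \<open>conn\<close> is
  made of.\<close>

lemma conn_unique:
  assumes D: "affine_connection E M D" and par: "\<And>A. A \<in> F \<Longrightarrow> parallel_field E M D (frame_field M \<iota> A)"
  shows "D = conn"
proof (intro ext)
  interpret D: affine_conn E M D
    using D by unfold_locales
  \<comment> \<open>The model space is regarded as open in itself, which gives access to
    \<open>onb F\<close>.\<close>
  interpret F: rel_open F F
    using subspace_F by unfold_locales auto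
  fix X Y x
  show "D X Y x = conn X Y x"
  proof (cases "X \<in> vector_fields E M \<and> Y \<in> vector_fields E M")
    case True
    then have X: "X \<in> vector_fields E M" and Y: "Y \<in> vector_fields E M"
      by auto
    show ?thesis
    proof (cases "x \<in> M")
      case x: True
      let ?f = "\<lambda>b x. \<theta> x (Y x) \<bullet> b" and ?e = "\<lambda>b. frame_field M \<iota> b"
      have Yx: "Y = (\<lambda>x. \<Sum>b\<in>onb F. ?f b x *\<^sub>R ?e b x)"
      proof
        fix x show "Y x = (\<Sum>b\<in>onb F. ?f b x *\<^sub>R ?e b x)"
        proof (cases "x \<in> M")
          case x: True
          have "Y x = \<iota> x (\<theta> x (Y x))"
            using vector_fieldsD(3)[OF Y x] x by (simp add: iota_theta)
          also have "\<dots> = (\<Sum>b\<in>onb F. ?f b x *\<^sub>R ?e b x)"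
            using F.linear_onb_expand[OF linear_iota[OF x] theta_in[OF x vector_fieldsD(3)[OF Y x]]] x
            by (simp add: frame_field_def)
          finally show ?thesis .
        next
          case False
          then show ?thesis
            using vector_fieldsD(4)[OF Y] by (simp add: frame_field_def)
        qed
      qed
      have f: "smooth_on E M (?f b)" for b
        by (intro smooth_on_bounded_linear[OF bounded_linear_inner_left] smooth_theta_field Y)
      have "D X Y = D X (\<lambda>x. \<Sum>b\<in>onb F. ?f b x *\<^sub>R ?e b x)"
        using Yx by simp
      also have "\<dots> = (\<lambda>x. \<Sum>b\<in>onb F. dird M (?f b) x (X x) *\<^sub>R ?e b x + ?f b x *\<^sub>R D X (?e b) x)"
        by (intro D.conn_sum_right f frame_field_in F.onb_in X)
      finally have "D X Y x = (\<Sum>b\<in>onb F. dird M (?f b) x (X x) *\<^sub>R ?e b x)"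
        using par[OF F.onb_in] X by (simp add: parallel_field_def)
      also have "\<dots> = (\<Sum>b\<in>onb F. (dird M (\<lambda>x. \<theta> x (Y x)) x (X x) \<bullet> b) *\<^sub>R \<iota> x b)"
        using x dird_bounded_linear[OF bounded_linear_inner_left smooth_theta_field[OF Y] x vector_fieldsD(3)[OF X x]]
        by (simp add: frame_field_def)
      also have "\<dots> = conn X Y x"
        using F.linear_onb_expand[OF linear_iota[OF x] dird_theta_field_in[OF Y x vector_fieldsD(3)[OF X x]]]
        by (simp add: conn_apply[OF X Y x])
      finally show ?thesis .
    next
      case False
      then show ?thesis
        using vector_fieldsD(4)[OF D.conn_in[OF X Y]] by (simp add: conn_outside)
    qed
  next
    case False
    then have "D X Y = (\<lambda>x. 0)"
      by (intro D.conn_not_in) blast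
    then show ?thesis
      using False by (auto simp: frame_conn_def)
  qed
qed

end

text \<open>The assumption \<open>rel\<close> says that the differential of \<open>\<phi>\<close>
  carries one frame to the other. A field on \<open>N\<close> and its pull-back then have the same
  coordinates up to composition with \<open>\<phi>\<close>, and the chain rule matches their
  derivatives. It serves both for right translations and for \<open>Phi\<close>.\<close>

lemma push_frame_conn:
  assumes "framed E M F \<theta> \<iota>" "framed E' N F \<theta>' \<iota>'"
    and \<phi>: "smooth_on E M \<phi>" "\<phi> ` M \<subseteq> N" and \<psi>: "smooth_on E' N \<psi>" "\<psi> ` N \<subseteq> M"
    and inv: "\<And>x. x \<in> M \<Longrightarrow> \<psi> (\<phi> x) = x" "\<And>y. y \<in> N \<Longrightarrow> \<phi> (\<psi> y) = y"
    and rel: "\<And>x w. \<lbrakk>x \<in> M; w \<in> E\<rbrakk> \<Longrightarrow> \<theta>' (\<phi> x) (dird M \<phi> x w) = \<theta> x w"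
  shows "push_conn M E' N \<phi> \<psi> (frame_conn E M \<theta> \<iota>) = frame_conn E' N \<theta>' \<iota>'"
proof (intro ext)
  interpret M: framed E M F \<theta> \<iota> by fact
  interpret N: framed E' N F \<theta>' \<iota>' by fact
  have \<phi>E: "\<phi> ` M \<subseteq> E'" and \<psi>E: "\<psi> ` N \<subseteq> E"
    using \<phi>(2) \<psi>(2) M.M_subset N.M_subset by auto
  have d\<phi>: "dird M \<phi> x w \<in> E'" if "x \<in> M" "w \<in> E" for x w
    by (rule M.dird_in_subspace[OF \<phi>(1) N.subspace_E \<phi>E that])
  have d\<psi>: "dird N \<psi> y w \<in> E" if "y \<in> N" "w \<in> E'" for y w
    by (rule N.dird_in_subspace[OF \<psi>(1) M.subspace_E \<psi>E that])
  \<comment> \<open>Differentiating \<open>\<phi> (\<psi> y) = y\<close>; hence pulling a field back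
    and pushing it forward restores it.\<close>
  have d\<phi>\<psi>: "dird M \<phi> (\<psi> y) (dird N \<psi> y w) = w" if y: "y \<in> N" and w: "w \<in> E'" for y w
  proof -
    have "dird M \<phi> (\<psi> y) (dird N \<psi> y w) = dird N (\<lambda>y. \<phi> (\<psi> y)) y w"
      using dird_compose[OF N.feasible_domain_axioms M.feasible_domain_axioms \<psi> \<phi>(1) y w] by simp
    also have "\<dots> = dird N (\<lambda>y. y) y w"
      using dird_transform[OF inv(2) y] by simp
    also have "\<dots> = w"
      using N.dird_eq[OF has_derivative_ident y w] .
    finally show ?thesis .
  qed
  fix X Y y
  show "push_conn M E' N \<phi> \<psi> (frame_conn E M \<theta> \<iota>) X Y y = frame_conn E' N \<theta>' \<iota>' X Y y"
  proof (cases "X \<in> vector_fields E' N \<and> Y \<in> vector_fields E' N \<and> y \<in> N")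
    case True
    then have X: "X \<in> vector_fields E' N" and Y: "Y \<in> vector_fields E' N" and y: "y \<in> N"
      by auto
    let ?pull = "push_field N M \<psi> \<phi>"
    have pull: "?pull Z \<in> vector_fields E M" if Z: "Z \<in> vector_fields E' N" for Z
    proof -
      have "smooth_on E' N (\<lambda>y. dird N \<psi> y (Z y))"
        by (rule N.smooth_on_dird_field[OF \<psi>(1) N.vector_fieldsD(1,2)[OF Z]])
      then have "smooth_on E M (\<lambda>x. dird N \<psi> (\<phi> x) (Z (\<phi> x)))"
        by (rule smooth_on_compose[OF M.feasible_domain_axioms N.rel_open_axioms \<phi>])
      then show ?thesis
        unfolding push_field_def
        using \<phi>(2) N.vector_fieldsD(3)[OF Z] by (intro M.vector_fields_extend d\<psi>) auto
    qed
    have d\<phi>_pull: "dird M \<phi> x (?pull Z x) = Z (\<phi> x)"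
      if "Z \<in> vector_fields E' N" "x \<in> M" for Z x
      using d\<phi>\<psi>[of "\<phi> x" "Z (\<phi> x)"] N.vector_fieldsD(3)[OF that(1)] \<phi>(2) that(2) inv(1)
      by (auto simp: push_field_def)
    have \<theta>_pull: "\<theta> x (?pull Z x) = \<theta>' (\<phi> x) (Z (\<phi> x))"
      if "Z \<in> vector_fields E' N" "x \<in> M" for Z x
      using rel[OF that(2) M.vector_fieldsD(3)[OF pull[OF that(1)] that(2)]] d\<phi>_pull[OF that] by simp
    have x: "\<psi> y \<in> M"
      using y \<psi>(2) by blast
    define A where "A = dird N (\<lambda>y. \<theta>' y (Y y)) y (X y)"
    have A: "A \<in> F"
      unfolding A_def by (rule N.dird_theta_field_in[OF Y y N.vector_fieldsD(3)[OF X y]])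
    have "dird M (\<lambda>x. \<theta> x (?pull Y x)) (\<psi> y) = dird M (\<lambda>x. \<theta>' (\<phi> x) (Y (\<phi> x))) (\<psi> y)"
      by (rule dird_transform[OF \<theta>_pull[OF Y] x])
    then have "dird M (\<lambda>x. \<theta> x (?pull Y x)) (\<psi> y) (?pull X (\<psi> y)) = A"
      using dird_compose[OF M.feasible_domain_axioms N.feasible_domain_axioms \<phi>
          N.smooth_theta_field[OF Y] x M.vector_fieldsD(3)[OF pull[OF X] x]]
      by (simp add: d\<phi>_pull[OF X x] inv(2)[OF y] A_def)
    then have "push_conn M E' N \<phi> \<psi> M.conn X Y y = dird M \<phi> (\<psi> y) (\<iota> (\<psi> y) A)"
      using X Y y M.conn_apply[OF pull[OF X] pull[OF Y] x]
      by (simp add: push_conn_def push_field_def[of M N])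
    also have "\<dots> = \<iota>' y A"
      using N.iota_theta[OF y d\<phi>[OF x M.iota_in[OF x A]]] rel[OF x M.iota_in[OF x A]]
      by (simp add: inv(2)[OF y] M.theta_iota[OF x A])
    also have "\<dots> = N.conn X Y y"
      by (simp add: N.conn_apply[OF X Y y] A_def)
    finally show ?thesis .
  next
    case False
    then show ?thesis
      by (auto simp: push_conn_def push_field_def frame_conn_def)
  qed
qed

section \<open>The matrix exponential\<close>

lemma bounded_bilinear_matrix_mult: "bounded_bilinear ((**) :: mat3 \<Rightarrow> mat3 \<Rightarrow> mat3)"
  unfolding bilinear_conv_bounded_bilinear[symmetric] bilinear_def
  by (auto intro!: linearI
      simp: matrix_matrix_mult_def vec_eq_iff sum.distrib algebra_simps sum_distrib_left)

lemmas mult_simps =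
  bounded_bilinear.diff_left[OF bounded_bilinear_matrix_mult]
  bounded_bilinear.diff_right[OF bounded_bilinear_matrix_mult]
  bounded_bilinear.add_left[OF bounded_bilinear_matrix_mult]
  bounded_bilinear.add_right[OF bounded_bilinear_matrix_mult]
  bounded_bilinear.minus_left[OF bounded_bilinear_matrix_mult]
  bounded_bilinear.minus_right[OF bounded_bilinear_matrix_mult]
  bounded_bilinear.scaleR_left[OF bounded_bilinear_matrix_mult]
  bounded_bilinear.scaleR_right[OF bounded_bilinear_matrix_mult]
  bounded_bilinear.zero_left[OF bounded_bilinear_matrix_mult]
  bounded_bilinear.zero_right[OF bounded_bilinear_matrix_mult]

abbreviation mpower :: "mat3 \<Rightarrow> nat \<Rightarrow> mat3" where
  "mpower A n \<equiv> ((**) A ^^ n) (mat 1)"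

lemma mpower_intertwine:
  fixes P A B :: mat3
  assumes "P ** A = B ** P"
  shows "P ** mpower A n = mpower B n ** P"
  by (induction n) (simp_all add: matrix_mul_assoc assms, simp flip: matrix_mul_assoc)

lemma mpower_scaleR: "mpower (t *\<^sub>R A) n = t ^ n *\<^sub>R mpower A n"
  by (induction n) (simp_all add: mult_simps)

lemma mpower_transpose: "transpose (mpower A n) = mpower (transpose A) n"
proof (induction n)
  case (Suc n)
  then show ?case
    using mpower_intertwine[of "transpose A" "transpose A" "transpose A" n]
    by (simp add: matrix_transpose_mul)
qed (simp add: transpose_mat)

text \<open>Comparison with the exponential series at \<open>norm A * K\<close>, where
  \<open>K\<close> bounds the matrix product as a bilinear map. The factor
  \<open>norm (mat 1)\<close> comes from the zeroth power.\<close>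

lemma summable_mexp: "summable (\<lambda>n. (1 / fact n) *\<^sub>R mpower A n)"
proof -
  obtain K where K: "K > 0" "\<forall>(a::mat3) (b::mat3). norm (a ** b) \<le> norm a * norm b * K"
    using bounded_bilinear.pos_bounded[OF bounded_bilinear_matrix_mult] by auto
  have bound: "norm (mpower A n) \<le> norm (mat 1 :: mat3) * (norm A * K) ^ n" for n
  proof (induction n)
    case (Suc n)
    have "norm (mpower A (Suc n)) \<le> norm A * K * norm (mpower A n)"
      using K(2)[rule_format, of A "mpower A n"] by (simp add: ac_simps)
    also have "\<dots> \<le> norm A * K * (norm (mat 1 :: mat3) * (norm A * K) ^ n)"
      using Suc K(1) by (intro mult_left_mono) auto
    finally show ?case
      by (simp add: ac_simps)
  qed simp
  have "summable (\<lambda>n. norm (mat 1 :: mat3) * (inverse (fact n) * (norm A * K) ^ n))"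
    by (intro summable_mult summable_exp)
  moreover have "norm ((1 / fact n) *\<^sub>R mpower A n) \<le> norm (mat 1 :: mat3) * (inverse (fact n) * (norm A * K) ^ n)" for n
    using mult_left_mono[OF bound[of n], of "inverse (fact n)"] by (simp add: field_simps)
  ultimately show ?thesis
    by (rule summable_comparison_test'[where N=0])
qed

lemma mexp_sums: "(\<lambda>n. (1 / fact n) *\<^sub>R mpower A n) sums mexp A"
  unfolding mexp_def by (rule summable_sums[OF summable_mexp])

lemma linear_mexp_sums:
  fixes f :: "mat3 \<Rightarrow> 'b::real_normed_vector"
  assumes "linear f"
  shows "(\<lambda>n. (1 / fact n) *\<^sub>R f (mpower A n)) sums f (mexp A)"
  using bounded_linear.sums[OF linear_conv_bounded_linear[THEN iffD1, OF assms] mexp_sums, of A]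
  by (simp add: linear_scale[OF assms])

lemma mexp_in_subspace:
  assumes "subspace S" "\<And>n. mpower A n \<in> S"
  shows "mexp A \<in> S"
proof -
  have "(\<lambda>N. \<Sum>n<N. (1 / fact n) *\<^sub>R mpower A n) \<longlonglongrightarrow> mexp A"
    using mexp_sums by (simp add: sums_def)
  then show ?thesis
    by (rule closed_sequentially[OF closed_subspace[OF assms(1)], rotated])
      (intro subspace_sum subspace_scale assms)
qed

text \<open>One statement for two uses: \<open>A\<close> commutes with its exponential
  (\<open>P = A\<close>), and conjugation by an invertible \<open>P\<close> passes through the
  exponential.\<close>

lemma mexp_intertwine:
  fixes P A B :: mat3
  assumes "P ** A = B ** P"
  shows "P ** mexp A = mexp B ** P"
proof (rule sums_unique2)
  have l: "linear (\<lambda>X :: mat3. P ** X)" and r: "linear (\<lambda>X :: mat3. X ** P)"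
    by (auto intro!: linearI simp: mult_simps)
  show "(\<lambda>n. (1 / fact n) *\<^sub>R (P ** mpower A n)) sums (P ** mexp A)"
    by (rule linear_mexp_sums[OF l])
  show "(\<lambda>n. (1 / fact n) *\<^sub>R (P ** mpower A n)) sums (mexp B ** P)"
    using linear_mexp_sums[OF r] by (simp add: mpower_intertwine[OF assms])
qed

lemma mexp_transpose: "transpose (mexp A) = mexp (transpose A)"
proof (rule sums_unique2)
  have "linear (transpose :: mat3 \<Rightarrow> mat3)"
    by (auto intro!: linearI simp: transpose_def vec_eq_iff)
  from linear_mexp_sums[OF this]
  show "(\<lambda>n. (1 / fact n) *\<^sub>R mpower (transpose A) n) sums transpose (mexp A)"
    by (simp add: mpower_transpose)
qed (rule mexp_sums)

lemma mexp_zero: "mexp 0 = mat 1"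
proof (rule sums_unique2[OF mexp_sums])
  have "mpower 0 n = (if n = 0 then mat 1 else 0)" for n
    by (cases n) (auto simp: mult_simps)
  then have "(\<lambda>n. (1 / fact n) *\<^sub>R mpower 0 n) = (\<lambda>n. if n = 0 then mat 1 else 0)"
    by auto
  then show "(\<lambda>n. (1 / fact n) *\<^sub>R mpower 0 n) sums mat 1"
    using sums_single[of 0 "\<lambda>_. mat 1 :: mat3"] by simp
qed

text \<open>Each component in direction \<open>b\<close> is a real power series in \<open>t\<close>
  that converges everywhere, so it may be differentiated termwise.\<close>

lemma mexp_deriv: "((\<lambda>t. mexp (t *\<^sub>R A)) has_vector_derivative A ** mexp (t *\<^sub>R A)) (at t within S)"
proof -
  have *: "((\<lambda>t. mexp (t *\<^sub>R A) \<bullet> b) has_real_derivative (A ** mexp (t *\<^sub>R A)) \<bullet> b) (at t)" for b t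
  proof -
    let ?c = "\<lambda>n. (mpower A n \<bullet> b) / fact n"
    have lin: "linear (\<lambda>X. X \<bullet> b)" "linear (\<lambda>X. (A ** X) \<bullet> b)"
      by (auto intro!: linearI simp: mult_simps inner_add_left)
    have 1: "(\<lambda>n. ?c n * t ^ n) sums (mexp (t *\<^sub>R A) \<bullet> b)" for t
      using linear_mexp_sums[OF lin(1), of "t *\<^sub>R A"] by (simp add: mpower_scaleR field_simps)
    have "(\<lambda>n. diffs ?c n * t ^ n) sums ((A ** mexp (t *\<^sub>R A)) \<bullet> b)"
    proof -
      \<comment> \<open>The factor n + 1 in \<open>diffs\<close> cancels against the factorial and
        leaves one extra factor \<open>A\<close> on the left.\<close>
      have "diffs ?c n * t ^ n = (1 / fact n) *\<^sub>R ((A ** mpower (t *\<^sub>R A) n) \<bullet> b)" for n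
        by (simp add: diffs_def mpower_scaleR mult_simps del: of_nat_Suc)
      then show ?thesis
        using linear_mexp_sums[OF lin(2), of "t *\<^sub>R A"] by simp
    qed
    moreover have "(\<lambda>t. mexp (t *\<^sub>R A) \<bullet> b) = (\<lambda>t. \<Sum>n. ?c n * t ^ n)"
      using sums_unique[OF 1] by blast
    ultimately show ?thesis
      using termdiffs_strong_converges_everywhere[of ?c t, OF sums_summable[OF 1]]
      by (simp only: sums_unique[symmetric])
  qed
  have "((\<lambda>t. mexp (t *\<^sub>R A) \<bullet> b) has_derivative (\<lambda>d. (d *\<^sub>R (A ** mexp (t *\<^sub>R A))) \<bullet> b)) (at t within S)"
    for b
    using has_derivative_at_withinI[OF has_field_derivative_imp_has_derivative[OF *[of b t]], of S]
    by (simp add: mult_commute_abs)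
  then show ?thesis
    unfolding has_vector_derivative_def has_derivative_componentwise_within[of "\<lambda>t. mexp (t *\<^sub>R A)"]
    by blast
qed

lemma mexp_commute: "A ** mexp (t *\<^sub>R A) = mexp (t *\<^sub>R A) ** A"
  by (rule mexp_intertwine) (simp add: mult_simps)

lemma mexp_neg_deriv:
  "((\<lambda>t. mexp (- t *\<^sub>R A)) has_vector_derivative - (mexp (- t *\<^sub>R A) ** A)) (at t within S)"
  using mexp_deriv[of "- A" t S] by (simp add: mult_simps mexp_commute[of A "- t", simplified])

text \<open>Conjugating by the fundamental solutions turns the linear equation into Z' = 0.\<close>

lemma sandwich_ode_unique:
  fixes Y :: "real \<Rightarrow> mat3"
  assumes "convex S"
    and Y: "\<And>t. t \<in> S \<Longrightarrow> (Y has_vector_derivative A ** Y t + Y t ** B) (at t within S)"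
    and "s \<in> S" "t \<in> S"
  shows "mexp (- s *\<^sub>R A) ** Y s ** mexp (- s *\<^sub>R B) = mexp (- t *\<^sub>R A) ** Y t ** mexp (- t *\<^sub>R B)"
proof -
  let ?Z = "\<lambda>t. mexp (- t *\<^sub>R A) ** Y t ** mexp (- t *\<^sub>R B)"
  have "(?Z has_vector_derivative 0) (at t within S)" if t: "t \<in> S" for t
  proof -
    have "(?Z has_vector_derivative
        (mexp (- t *\<^sub>R A) ** Y t) ** (- (mexp (- t *\<^sub>R B) ** B))
        + (mexp (- t *\<^sub>R A) ** (A ** Y t + Y t ** B) + (- (mexp (- t *\<^sub>R A) ** A)) ** Y t) ** mexp (- t *\<^sub>R B))
        (at t within S)"
      by (intro bounded_bilinear.has_vector_derivative[OF bounded_bilinear_matrix_mult] mexp_neg_deriv Y t)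
    moreover have "(mexp (- t *\<^sub>R A) ** Y t) ** (- (mexp (- t *\<^sub>R B) ** B))
        + (mexp (- t *\<^sub>R A) ** (A ** Y t + Y t ** B) + (- (mexp (- t *\<^sub>R A) ** A)) ** Y t) ** mexp (- t *\<^sub>R B) = 0"
      unfolding mexp_commute[of B "- t", symmetric] by (simp add: mult_simps matrix_mul_assoc)
    ultimately show ?thesis
      by (simp only:)
  qed
  then have "\<exists>c. \<forall>t\<in>S. ?Z t = c"
    by (intro has_derivative_zero_constant[OF assms(1)]) (simp add: has_vector_derivative_def)
  then show ?thesis
    using assms(3,4) by metis
qed

lemma mexp_minus_mult: "mexp (- A) ** mexp A = mat 1"
  using sandwich_ode_unique[of UNIV "\<lambda>t. mexp (t *\<^sub>R A)" A 0 1 0] mexp_deriv[of A]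
  by (simp add: mult_simps mexp_zero)

lemma mexp_mult_minus: "mexp A ** mexp (- A) = mat 1"
  using mexp_minus_mult[of "- A"] by simp

text \<open>As a function of \<open>t\<close> the left side solves \<open>Y' = A Y\<close> with
  value \<open>mexp (s A)\<close> at 0, so uniqueness for the linear equation replaces a computation
  with double series.\<close>

lemma mexp_add_scaleR: "mexp ((t + s) *\<^sub>R A) = mexp (t *\<^sub>R A) ** mexp (s *\<^sub>R A)"
proof -
  have "((\<lambda>t. mexp ((t + s) *\<^sub>R A)) has_vector_derivative A ** mexp ((t + s) *\<^sub>R A)) (at t)" for t
  proof -
    have "((\<lambda>t. t + s) has_vector_derivative 1) (at t)"
      by (auto intro!: derivative_eq_intros)
    from vector_diff_chain_at[OF this mexp_deriv[of A "t + s" UNIV]] show ?thesis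
      by (simp add: o_def)
  qed
  then have "mexp (- t *\<^sub>R A) ** mexp ((t + s) *\<^sub>R A) = mexp (s *\<^sub>R A)"
    using sandwich_ode_unique[of UNIV "\<lambda>t. mexp ((t + s) *\<^sub>R A)" A 0 t 0]
    by (simp add: mult_simps mexp_zero)
  then have "mexp (t *\<^sub>R A) ** mexp (- (t *\<^sub>R A)) ** mexp ((t + s) *\<^sub>R A) = mexp (t *\<^sub>R A) ** mexp (s *\<^sub>R A)"
    by (simp flip: matrix_mul_assoc)
  then show ?thesis
    by (simp add: mexp_mult_minus)
qed

section \<open>Uniqueness of logarithms with real spectrum\<close>

lemma zero_derivative_imp_zero:
  fixes g :: "real \<Rightarrow> real"
  assumes g: "\<And>t. (g has_real_derivative 0) (at t)" and "g s = 0"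
  shows "g t = 0"
  using DERIV_const_ratio_const[of s t g 0] assms by (cases "s = t") auto

text \<open>The operators d/dt - a with real a, applied successively, annihilate f.\<close>

primrec kills :: "real list \<Rightarrow> (real \<Rightarrow> real) \<Rightarrow> bool" where
  "kills [] f = (\<forall>t. f t = 0)"
| "kills (a # as) f =
    (\<exists>f'. (\<forall>t. (f has_real_derivative f' t) (at t)) \<and> kills as (\<lambda>t. f' t - a * f t))"

text \<open>By Rolle's theorem for exp(-a t) f(t), unbounded zero sets are inherited by f' - a f.\<close>

lemma kills_imp_zero:
  assumes "kills as f" "\<And>N::real. \<exists>t>N. f t = 0"
  shows "f t = 0"
  using assms
proof (induction as arbitrary: f t)
  case (Cons a as)
  then obtain f' where f': "\<And>t. (f has_real_derivative f' t) (at t)"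
    and kills: "kills as (\<lambda>t. f' t - a * f t)"
    by auto
  define h where "h = (\<lambda>t. exp (- a * t) * f t)"
  have h: "(h has_real_derivative exp (- a * t) * (f' t - a * f t)) (at t)" for t
    unfolding h_def by (auto intro!: derivative_eq_intros f' simp: algebra_simps)
  have "f' t - a * f t = 0" for t
  proof (rule Cons.IH[OF kills])
    fix N :: real
    obtain p where p: "p > N" "f p = 0"
      using Cons.prems(2) by blast
    obtain q where q: "q > p" "f q = 0"
      using Cons.prems(2) by blast
    have "\<exists>z. p < z \<and> z < q \<and> (h has_real_derivative 0) (at z)"
    proof (rule Rolle)
      show "continuous_on {p..q} h"
        using h by (intro DERIV_continuous_on) (blast intro: has_field_derivative_at_within)
      show "h differentiable (at x)" for x
        using h real_differentiable_def by blast
    qed (use p q in \<open>auto simp: h_def\<close>)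
    then obtain z where "p < z" "exp (- a * z) * (f' z - a * f z) = 0"
      using DERIV_unique[OF h] by blast
    then show "\<exists>t>N. f' t - a * f t = 0"
      using p by (intro exI[of _ z]) auto
  qed
  then have "(h has_real_derivative 0) (at t)" for t
    using h[of t] by simp
  moreover obtain s where "f s = 0"
    using Cons.prems(2) by blast
  ultimately have "h t = 0"
    using zero_derivative_imp_zero[of h s t] by (simp add: h_def)
  then show ?case
    by (simp add: h_def)
qed simp

text \<open>Vanishing of this product says that \<open>L\<close> is annihilated by a polynomial with
  only real roots, the list holding the roots with multiplicity. In this form a real spectrum can be
  fed into \<open>kills\<close>.\<close>

primrec shifted_prod :: "mat3 \<Rightarrow> real list \<Rightarrow> mat3" where
  "shifted_prod L [] = mat 1"
| "shifted_prod L (a # as) = (L - a *\<^sub>R mat 1) ** shifted_prod L as"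

lemma shifted_prod_append: "shifted_prod L (as @ bs) = shifted_prod L as ** shifted_prod L bs"
  by (induction as) (simp_all add: matrix_mul_assoc)

text \<open>The operator d/dt - a replaces \<open>P\<close> by \<open>P ** (L - a)\<close> in front
  of \<open>mexp (t L)\<close>. Working through the list, the factors of \<open>shifted_prod\<close>
  accumulate in front of both exponentials until they vanish; the induction therefore runs over
  general \<open>P\<close> and \<open>Q\<close>.\<close>

lemma kills_mexp:
  fixes P Q :: mat3
  assumes "P ** shifted_prod L as = 0" "Q ** shifted_prod M as = 0"
  shows "kills as (\<lambda>t. (P ** mexp (t *\<^sub>R L) - Q ** mexp (t *\<^sub>R M)) \<bullet> b)"
  using assms
proof (induction as arbitrary: P Q)
  case Nil
  then show ?case
    by (simp add: mult_simps)
next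
  case (Cons a as)
  let ?f' = "\<lambda>t. (P ** L ** mexp (t *\<^sub>R L) - Q ** M ** mexp (t *\<^sub>R M)) \<bullet> b"
  have d: "((\<lambda>t. R ** mexp (t *\<^sub>R N)) has_vector_derivative R ** N ** mexp (t *\<^sub>R N)) (at t)" for R N :: mat3 and t
    using bounded_linear.has_vector_derivative[OF bounded_bilinear.bounded_linear_right[OF
      bounded_bilinear_matrix_mult] mexp_deriv, of R N t UNIV] by (simp add: matrix_mul_assoc)
  have "((\<lambda>t. (P ** mexp (t *\<^sub>R L) - Q ** mexp (t *\<^sub>R M)) \<bullet> b) has_real_derivative ?f' t) (at t)" for t
    unfolding has_real_derivative_iff_has_vector_derivative
    by (intro bounded_linear.has_vector_derivative[OF bounded_linear_inner_left] has_vector_derivative_diff d)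
  moreover have "kills as (\<lambda>t. ((P ** (L - a *\<^sub>R mat 1)) ** mexp (t *\<^sub>R L)
      - (Q ** (M - a *\<^sub>R mat 1)) ** mexp (t *\<^sub>R M)) \<bullet> b)"
    using Cons.prems by (intro Cons.IH) (simp_all flip: matrix_mul_assoc)
  then have "kills as (\<lambda>t. ?f' t - a * ((P ** mexp (t *\<^sub>R L) - Q ** mexp (t *\<^sub>R M)) \<bullet> b))"
    by (simp add: mult_simps inner_diff_left algebra_simps)
  ultimately show ?case
    unfolding kills.simps by (intro exI[of _ ?f'] conjI allI)
qed

text \<open>Equality at time 1 spreads to all natural times, and the difference of the exponentials,
  killed by finitely many operators with real parameters, then vanishes identically. Differentiating
  at 0 recovers \<open>L\<close> and \<open>M\<close>.\<close>

lemma mexp_inj_real_spectrum: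
  assumes eq: "mexp L = mexp M" and L: "shifted_prod L as = 0" and M: "shifted_prod M bs = 0"
  shows "L = M"
proof -
  have nat: "mexp (real n *\<^sub>R L) = mexp (real n *\<^sub>R M)" for n
    by (induction n) (simp_all add: mexp_add_scaleR mexp_zero eq add.commute[of 1])
  have "(mexp (t *\<^sub>R L) - mexp (t *\<^sub>R M)) \<bullet> b = 0" for t b
  proof (rule kills_imp_zero[where f="\<lambda>t. (mexp (t *\<^sub>R L) - mexp (t *\<^sub>R M)) \<bullet> b"])
    \<comment> \<open>The concatenated list works for both matrices: for \<open>L\<close> the factor
      from \<open>as\<close> vanishes, for \<open>M\<close> the one from \<open>bs\<close>.\<close>
    have "kills (bs @ as) (\<lambda>t. (mat 1 ** mexp (t *\<^sub>R L) - mat 1 ** mexp (t *\<^sub>R M)) \<bullet> b)"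
      using L M by (intro kills_mexp) (simp_all add: shifted_prod_append mult_simps)
    then show "kills (bs @ as) (\<lambda>t. (mexp (t *\<^sub>R L) - mexp (t *\<^sub>R M)) \<bullet> b)"
      by simp
    show "\<exists>t>N. (mexp (t *\<^sub>R L) - mexp (t *\<^sub>R M)) \<bullet> b = 0" for N
      using reals_Archimedean2[of N] nat by auto
  qed
  then have "mexp (t *\<^sub>R L) = mexp (t *\<^sub>R M)" for t
    by (metis inner_eq_zero_iff right_minus_eq)
  then show ?thesis
    using vector_derivative_unique_at[OF mexp_deriv[of L 0 UNIV], of "M ** mexp (0 *\<^sub>R M)"] mexp_deriv[of M 0 UNIV]
    by (simp add: mexp_zero)
qed

section \<open>Triangular matrices and the principal logarithm\<close>

lemma mat3_eq_iff: "(A :: 'a^3^3) = B \<longleftrightarrow>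
    A$1$1 = B$1$1 \<and> A$1$2 = B$1$2 \<and> A$1$3 = B$1$3 \<and>
    A$2$1 = B$2$1 \<and> A$2$2 = B$2$2 \<and> A$2$3 = B$2$3 \<and>
    A$3$1 = B$3$1 \<and> A$3$2 = B$3$2 \<and> A$3$3 = B$3$3"
  by (auto simp: vec_eq_iff forall_3)

lemma mat3_mult: "(A ** B) $ i $ j = A$i$1 * B$1$j + A$i$2 * B$2$j + A$i$3 * B$3$j"
  for A B :: "'a::semiring_1^3^3"
  by (simp add: matrix_matrix_mult_def sum_3)

lemma mat3_mult_vec: "(A *v w) $ i = A$i$1 * w$1 + A$i$2 * w$2 + A$i$3 * w$3"
  for A :: "'a::semiring_1^3^3"
  by (simp add: matrix_vector_mult_def sum_3)

section \<open>Characteristic polynomial and real spectrum\<close>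

lemma cayley_hamilton_3:
  fixes L :: mat3
  shows "L ** (L ** L) - (L$1$1 + L$2$2 + L$3$3) *\<^sub>R (L ** L)
    + (L$1$1 * L$2$2 - L$1$2 * L$2$1 + L$1$1 * L$3$3 - L$1$3 * L$3$1 + L$2$2 * L$3$3 - L$2$3 * L$3$2) *\<^sub>R L
    - det L *\<^sub>R mat 1 = 0"
  by (simp add: mat3_eq_iff mat3_mult det_3 mat_def algebra_simps)

lemma complex_eigenvalue_of_det:
  assumes "det ((\<chi> i j. complex_of_real (L$i$j)) - mat z) = 0"
  shows "complex_eigenvalue L z"
proof -
  let ?A = "(\<chi> i j. complex_of_real (L$i$j)) - mat z :: complex^3^3"
  have "\<not> (\<exists>B. B ** ?A = mat 1)"
    using assms by (metis invertible_det_nz invertible_left_inverse)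
  then obtain w where w: "w \<noteq> 0" "?A *v w = 0"
    unfolding matrix_left_invertible_ker by blast
  then have "(\<chi> i j. complex_of_real (L$i$j)) *v w = z *s w"
    by (simp add: vec_eq_iff forall_3 mat3_mult_vec mat_def algebra_simps)
  then show ?thesis
    using w(1) unfolding complex_eigenvalue_def by blast
qed

text \<open>The characteristic polynomial splits over the complex numbers, its roots are eigenvalues
  and hence real, and Cayley-Hamilton turns the factorisation into a vanishing matrix
  product.\<close>

lemma shifted_prod_real_spectrum:
  assumes real: "\<And>z. complex_eigenvalue L z \<Longrightarrow> Im z = 0"
  obtains as where "shifted_prod L as = 0"
proof -
  define s1 where "s1 = L$1$1 + L$2$2 + L$3$3"
  define s2 where "s2 = L$1$1 * L$2$2 - L$1$2 * L$2$1 + L$1$1 * L$3$3 - L$1$3 * L$3$1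
    + L$2$2 * L$3$3 - L$2$3 * L$3$2"
  define p :: "complex poly" where
    "p = [:- of_real (det L), of_real s2, - of_real s1, 1:]"
  have root: "Im z = 0" if "poly p z = 0" for z
  proof (rule real, rule complex_eigenvalue_of_det)
    \<comment> \<open>\<open>p\<close> is the determinant of z - L; the sign comes from the odd
      size.\<close>
    have "poly p z = - det ((\<chi> i j. complex_of_real (L$i$j)) - mat z)"
      by (simp add: p_def s1_def s2_def det_3 mat_def algebra_simps)
    with that show "det ((\<chi> i j. complex_of_real (L$i$j)) - mat z) = 0"
      by simp
  qed
  have "p \<noteq> 0" "degree p = 3" "lead_coeff p = 1"
    by (auto simp: p_def)
  then obtain Z where Z: "size Z = 3" "p = (\<Prod>x\<in>#Z. [:-x, 1:])"
    using alg_closed_imp_factorization[of p] by auto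
  obtain a Z1 where Z1: "Z = add_mset a Z1" "size Z1 = 2"
    using size_eq_Suc_imp_eq_union[of Z 2] Z(1) by auto
  obtain b Z2 where Z2: "Z1 = add_mset b Z2" "size Z2 = 1"
    using size_eq_Suc_imp_eq_union[of Z1 1] Z1(2) by auto
  obtain c where "Z2 = {#c#}"
    using size_1_singleton_mset[OF Z2(2)] by auto
  with Z Z1 Z2 have p: "p = [:-a, 1:] * ([:-b, 1:] * [:-c, 1:])"
    by simp
  have "poly p a = 0" "poly p b = 0" "poly p c = 0"
    unfolding p poly_mult by simp_all
  then have "Im a = 0" "Im b = 0" "Im c = 0"
    by (blast intro: root)+
  then obtain a' b' c' where abc: "a = of_real a'" "b = of_real b'" "c = of_real c'"
    by (metis complex_is_Real_iff Reals_cases)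
  \<comment> \<open>Comparing coefficients of the two forms of \<open>p\<close> expresses the trace,
    the sum of principal minors and the determinant by the real roots.\<close>
  have "complex_of_real s1 = of_real (a' + b' + c')"
    "complex_of_real s2 = of_real (a' * b' + a' * c' + b' * c')"
    "complex_of_real (det L) = of_real (a' * b' * c')"
    using p unfolding p_def abc by (auto simp: algebra_simps)
  then have sym: "s1 = a' + b' + c'" "s2 = a' * b' + a' * c' + b' * c'" "det L = a' * b' * c'"
    unfolding of_real_eq_iff by auto
  have "shifted_prod L [a', b', c'] = L ** (L ** L) - s1 *\<^sub>R (L ** L) + s2 *\<^sub>R L - det L *\<^sub>R mat 1"
    unfolding sym by (simp add: mult_simps algebra_simps)
  also have "\<dots> = 0"
    using cayley_hamilton_3[of L] unfolding s1_def s2_def .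
  finally show ?thesis
    using that by blast
qed

text \<open>An eigenvector of \<open>L\<close> is one for each power, so summing the exponential
  series componentwise multiplies it by \<open>exp z\<close>.\<close>

lemma complex_eigenvalue_mexp:
  assumes "complex_eigenvalue L z"
  shows "complex_eigenvalue (mexp L) (exp z)"
proof -
  let ?c = "\<lambda>A :: mat3. (\<chi> i j. complex_of_real (A$i$j)) :: complex^3^3"
  obtain w where w: "w \<noteq> 0" "?c L *v w = z *s w"
    using assms unfolding complex_eigenvalue_def by blast
  have cmult: "?c (A ** B) = ?c A ** ?c B" for A B
    by (simp add: mat3_eq_iff mat3_mult)
  have cpow: "?c (mpower L n) *v w = z ^ n *s w" for n
  proof (induction n)
    case 0
    then show ?case
      by (simp add: vec_eq_iff forall_3 mat3_mult_vec mat_def)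
  next
    case (Suc n)
    have "?c (mpower L (Suc n)) *v w = ?c L *v (?c (mpower L n) *v w)"
      by (simp add: cmult matrix_vector_mul_assoc)
    also have "\<dots> = z ^ n *s (?c L *v w)"
      by (simp add: Suc vector_scalar_commute)
    finally show ?case
      by (simp add: w(2) vector_smult_assoc mult.commute)
  qed
  have "(?c (mexp L) *v w) $ i = exp z * w $ i" for i
  proof (rule sums_unique2)
    have "linear (\<lambda>A. (?c A *v w) $ i)"
      by (rule linearI; simp add: mat3_mult_vec; simp add: scaleR_conv_of_real algebra_simps)
    from linear_mexp_sums[OF this, of L]
    show "(\<lambda>n. (1 / fact n) *\<^sub>R (z ^ n * w $ i)) sums (?c (mexp L) *v w) $ i"
      by (simp add: cpow)
    show "(\<lambda>n. (1 / fact n) *\<^sub>R (z ^ n * w $ i)) sums (exp z * w $ i)"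
      using sums_mult2[OF exp_converges[of z], of "w $ i"] by (simp add: divide_inverse)
  qed
  then have "?c (mexp L) *v w = exp z *s w"
    by (simp add: vec_eq_iff)
  then show ?thesis
    using w(1) unfolding complex_eigenvalue_def by blast
qed

section \<open>Exponential and logarithm in the triangular algebra\<close>

definition lower :: "real \<Rightarrow> real \<Rightarrow> real \<Rightarrow> real \<Rightarrow> real \<Rightarrow> mat3" where
  "lower a b c p q = vector [vector [a, 0, 0], vector [0, b, 0], vector [p, q, c]]"

lemma lower_nth [simp]:
  "lower a b c p q $ 1 $ 1 = a" "lower a b c p q $ 1 $ 2 = 0" "lower a b c p q $ 1 $ 3 = 0"
  "lower a b c p q $ 2 $ 1 = 0" "lower a b c p q $ 2 $ 2 = b" "lower a b c p q $ 2 $ 3 = 0"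
  "lower a b c p q $ 3 $ 1 = p" "lower a b c p q $ 3 $ 2 = q" "lower a b c p q $ 3 $ 3 = c"
  by (simp_all add: lower_def)

lemma lower_in_hlie [simp]: "lower a b c p q \<in> hlie"
  by (simp add: hlie_def)

lemma hlieD:
  "A \<in> hlie \<Longrightarrow> A$1$2 = 0 \<and> A$1$3 = 0 \<and> A$2$3 = 0 \<and> A$2$1 = 0"
  by (simp add: hlie_def)

lemma subspace_hlie: "subspace hlie"
  by (auto simp: subspace_def hlie_def)

lemma hlie_mult: "\<lbrakk>A \<in> hlie; B \<in> hlie\<rbrakk> \<Longrightarrow> A ** B \<in> hlie"
  by (simp add: hlie_def mat3_mult)

lemma mat_1_in_hlie: "mat 1 \<in> hlie"
  by (simp add: hlie_def mat_def)

lemma mpower_in_hlie: "A \<in> hlie \<Longrightarrow> mpower A n \<in> hlie"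
  by (induction n) (auto simp: mat_1_in_hlie hlie_mult)

lemma mexp_in_hlie: "A \<in> hlie \<Longrightarrow> mexp A \<in> hlie"
  by (intro mexp_in_subspace subspace_hlie mpower_in_hlie)

lemma Hgrp_iff: "T \<in> Hgrp \<longleftrightarrow> T \<in> hlie \<and> T$1$1 > 0 \<and> T$2$2 > 0 \<and> T$3$3 > 0"
  by (simp add: Hgrp_def forall_3)

text \<open>The first nonzero component of an eigenvector forces \<open>z\<close> to be the diagonal
  entry in that row.\<close>

lemma hlie_eigenvalue_real:
  assumes A: "A \<in> hlie" and z: "complex_eigenvalue A z"
  obtains i where "z = of_real (A$i$i)"
proof -
  obtain w where w: "w \<noteq> 0" "(\<chi> i j. complex_of_real (A$i$j)) *v w = z *s w"
    using z unfolding complex_eigenvalue_def by blast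
  have "w$1 \<noteq> 0 \<or> w$2 \<noteq> 0 \<or> w$3 \<noteq> 0"
    using w(1) by (simp add: vec_eq_iff forall_3)
  moreover have "of_real (A$1$1) * w$1 = z * w$1" "of_real (A$2$2) * w$2 = z * w$2"
    "of_real (A$3$1) * w$1 + of_real (A$3$2) * w$2 + of_real (A$3$3) * w$3 = z * w$3"
    using w(2) hlieD[OF A] by (simp_all add: vec_eq_iff forall_3 mat3_mult_vec)
  ultimately have "z = of_real (A$1$1) \<or> z = of_real (A$2$2) \<or> z = of_real (A$3$3)"
    by (cases "w$1 = 0"; cases "w$2 = 0") auto
  then show ?thesis
    using that by blast
qed

text \<open>For an eigenvalue \<open>z\<close> of a logarithm, \<open>exp z\<close> is an eigenvalue
  of a matrix in \<open>Hgrp\<close>, hence a positive diagonal entry, and within the strip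
  \<open>Ln\<close> recovers \<open>z\<close> as a real number. \<open>L\<close> and
  \<open>M\<close> are arbitrary matrices, since \<open>mlog\<close> does not confine its candidates
  to \<open>hlie\<close>.\<close>

lemma mexp_inj_Hgrp:
  assumes T: "mexp L \<in> Hgrp" and eq: "mexp M = mexp L"
    and L: "\<And>z. complex_eigenvalue L z \<Longrightarrow> - pi < Im z \<and> Im z < pi"
    and M: "\<And>z. complex_eigenvalue M z \<Longrightarrow> - pi < Im z \<and> Im z < pi"
  shows "L = M"
proof -
  have real: "Im z = 0" if K: "mexp K = mexp L" and strip: "- pi < Im z \<and> Im z < pi"
    and z: "complex_eigenvalue K z" for K z
  proof -
    have T': "mexp K \<in> Hgrp"
      using T K by simp
    obtain i where i: "exp z = of_real (mexp K $ i $ i)"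
      using hlie_eigenvalue_real[OF _ complex_eigenvalue_mexp[OF z]] T' unfolding Hgrp_def by blast
    have "mexp K $ i $ i > 0"
      using T' unfolding Hgrp_def by blast
    moreover have "Ln (exp z) = z"
      using strip by (intro Ln_exp) auto
    ultimately have "z = of_real (ln (mexp K $ i $ i))"
      by (simp add: i Ln_of_real)
    then show ?thesis
      by simp
  qed
  obtain as where "shifted_prod L as = 0"
    using shifted_prod_real_spectrum[of L] real[OF refl L] by blast
  moreover obtain bs where "shifted_prod M bs = 0"
    using shifted_prod_real_spectrum[of M] real[OF eq M] by blast
  ultimately show ?thesis
    using mexp_inj_real_spectrum[OF eq[symmetric]] by blast
qed

text \<open>The divided difference of the n-th power: the (3,1) entry of the n-th power of a matrix A in
  hlie is A$3$1 times this quantity for the two diagonal entries involved.\<close>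

primrec pow_dd :: "real \<Rightarrow> real \<Rightarrow> nat \<Rightarrow> real" where
  "pow_dd x y 0 = 0"
| "pow_dd x y (Suc n) = x ^ n + y * pow_dd x y n"

text \<open>The sum is the divided difference of \<open>exp\<close>: its derivative if
  \<open>x = y\<close>, else the difference quotient. It is nonzero because \<open>exp\<close> is
  positive and injective, which permits division by it when a logarithm is built.\<close>

lemma pow_dd_exp_sums: "\<exists>d. d \<noteq> 0 \<and> (\<lambda>n. pow_dd x y n / fact n) sums d"
proof (cases "x = y")
  case True
  have "pow_dd y y n = real n * y ^ (n - 1)" for n
  proof (induction n)
    case (Suc n)
    then show ?case
      by (cases n) (auto simp: algebra_simps)
  qed simp
  \<comment> \<open>The term for n = 0 vanishes, so this is the exponential series shifted by
    one.\<close>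
  then have "pow_dd y y (Suc n) / fact (Suc n) = y ^ n /\<^sub>R fact n" for n
    by (simp add: divide_inverse del: of_nat_Suc pow_dd.simps)
  then have "(\<lambda>n. pow_dd y y n / fact n) sums exp y"
    using exp_converges[of y] sums_Suc_iff[of "\<lambda>n. pow_dd y y n / fact n" "exp y"] by simp
  then show ?thesis
    using True by (intro exI[of _ "exp y"]) simp
next
  case False
  have *: "(x - y) * pow_dd x y n = x ^ n - y ^ n" for n
  proof (induction n)
    case (Suc n)
    have "(x - y) * pow_dd x y (Suc n) = (x - y) * x ^ n + y * ((x - y) * pow_dd x y n)"
      by (simp add: algebra_simps)
    then show ?case
      unfolding Suc by (simp add: algebra_simps)
  qed simp
  have "pow_dd x y n / fact n = (x ^ n /\<^sub>R fact n - y ^ n /\<^sub>R fact n) / (x - y)" for n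
  proof -
    have "x ^ n /\<^sub>R fact n - y ^ n /\<^sub>R fact n = (x ^ n - y ^ n) / fact n"
      by (simp add: divide_inverse algebra_simps)
    then show ?thesis
      using False by (simp flip: *)
  qed
  then have "(\<lambda>n. pow_dd x y n / fact n) sums ((exp x - exp y) / (x - y))"
    using sums_divide[OF sums_diff[OF exp_converges[of x] exp_converges[of y]], of "x - y"] by simp
  then show ?thesis
    using False by (intro exI[of _ "(exp x - exp y) / (x - y)"]) simp
qed

lemma mpower_hlie_nth:
  assumes "A \<in> hlie"
  shows "mpower A n $ 1 $ 1 = A$1$1 ^ n" "mpower A n $ 2 $ 2 = A$2$2 ^ n" "mpower A n $ 3 $ 3 = A$3$3 ^ n"
    "mpower A n $ 3 $ 1 = A$3$1 * pow_dd (A$1$1) (A$3$3) n"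
    "mpower A n $ 3 $ 2 = A$3$2 * pow_dd (A$2$2) (A$3$3) n"
  using hlieD[OF assms] hlieD[OF mpower_in_hlie[OF assms]]
  by (induction n) (auto simp: mat_def mat3_mult algebra_simps)

lemma mexp_nth_sums: "(\<lambda>n. mpower A n $ i $ j / fact n) sums mexp A $ i $ j"
proof -
  have "linear (\<lambda>A :: mat3. A $ i $ j)"
    by (auto intro!: linearI)
  from linear_mexp_sums[OF this, of A] show ?thesis
    by simp
qed

lemma mexp_hlie_diag:
  assumes "A \<in> hlie"
  shows "mexp A $ i $ i = exp (A $ i $ i)"
proof (rule sums_unique2[OF mexp_nth_sums])
  have "mpower A n $ i $ i = A $ i $ i ^ n" for n
    using mpower_hlie_nth[OF assms, of n] exhaust_3[of i] by auto
  then show "(\<lambda>n. mpower A n $ i $ i / fact n) sums exp (A $ i $ i)"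
    using exp_converges[of "A $ i $ i"] by (simp add: divide_inverse mult.commute)
qed

lemma mexp_in_Hgrp: "A \<in> hlie \<Longrightarrow> mexp A \<in> Hgrp"
  by (simp add: Hgrp_def mexp_in_hlie mexp_hlie_diag)

text \<open>The off-diagonal entries of \<open>mexp L\<close> are those of \<open>L\<close> times
  divided differences of \<open>exp\<close> that depend on the diagonal alone. So \<open>ln\<close>
  fixes the diagonal and the remaining entries follow by division.\<close>

lemma hlie_log_exists:
  assumes T: "T \<in> Hgrp"
  obtains L where "L \<in> hlie" "mexp L = T"
proof -
  have pos: "T$1$1 > 0" "T$2$2 > 0" "T$3$3 > 0" and "T \<in> hlie"
    using T by (auto simp: Hgrp_iff)
  obtain d where d: "d \<noteq> 0" "(\<lambda>n. pow_dd (ln (T$1$1)) (ln (T$3$3)) n / fact n) sums d"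
    using pow_dd_exp_sums by blast
  obtain e where e: "e \<noteq> 0" "(\<lambda>n. pow_dd (ln (T$2$2)) (ln (T$3$3)) n / fact n) sums e"
    using pow_dd_exp_sums by blast
  define L where "L = lower (ln (T$1$1)) (ln (T$2$2)) (ln (T$3$3)) (T$3$1 / d) (T$3$2 / e)"
  have L: "L \<in> hlie"
    by (simp add: L_def)
  have L_nth: "L$1$1 = ln (T$1$1)" "L$2$2 = ln (T$2$2)" "L$3$3 = ln (T$3$3)"
    "L$3$1 = T$3$1 / d" "L$3$2 = T$3$2 / e"
    by (simp_all add: L_def)
  have "mexp L $ 3 $ 1 = T$3$1 / d * d"
    using mexp_nth_sums[of L 3 1] sums_mult[OF d(2), of "T$3$1 / d"]
    by (intro sums_unique2) (simp_all add: mpower_hlie_nth[OF L] L_nth)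
  moreover have "mexp L $ 3 $ 2 = T$3$2 / e * e"
    using mexp_nth_sums[of L 3 2] sums_mult[OF e(2), of "T$3$2 / e"]
    by (intro sums_unique2) (simp_all add: mpower_hlie_nth[OF L] L_nth)
  ultimately have "mexp L = T"
    using hlieD[OF mexp_in_hlie[OF L]] hlieD[OF \<open>T \<in> hlie\<close>] pos d(1) e(1)
    by (simp add: mat3_eq_iff mexp_hlie_diag[OF L] L_nth)
  then show ?thesis
    using that L by blast
qed

lemma mlog_Hgrp:
  assumes T: "T \<in> Hgrp"
  shows "mlog T \<in> hlie" "mexp (mlog T) = T"
proof -
  obtain L where L: "L \<in> hlie" "mexp L = T"
    using hlie_log_exists[OF T] .
  have strip: "- pi < Im z \<and> Im z < pi" if "complex_eigenvalue L z" for z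
    using hlie_eigenvalue_real[OF L(1) that] by (metis Im_complex_of_real neg_less_0_iff_less pi_gt_zero)
  have "mlog T = L"
    unfolding mlog_def
  proof (rule the_equality)
    fix M assume "mexp M = T \<and> (\<forall>z. complex_eigenvalue M z \<longrightarrow> - pi < Im z \<and> Im z < pi)"
    then show "M = L"
      using strip L T by (intro mexp_inj_Hgrp[of L M, symmetric]) auto
  qed (use L strip in blast)
  then show "mlog T \<in> hlie" "mexp (mlog T) = T"
    using L by auto
qed

section \<open>Cholesky factorisation\<close>

lemma smooth_on_lower:
  assumes "feasible_domain E M"
    and "smooth_on E M a" "smooth_on E M b" "smooth_on E M c" "smooth_on E M p" "smooth_on E M q"
  shows "smooth_on E M (\<lambda>x. lower (a x) (b x) (c x) (p x) (q x))"
proof -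
  interpret feasible_domain E M by fact
  have "(\<lambda>x. lower (a x) (b x) (c x) (p x) (q x))
    = (\<lambda>x. a x *\<^sub>R lower 1 0 0 0 0 + b x *\<^sub>R lower 0 1 0 0 0 + c x *\<^sub>R lower 0 0 1 0 0
      + p x *\<^sub>R lower 0 0 0 1 0 + q x *\<^sub>R lower 0 0 0 0 1)"
    by (simp add: mat3_eq_iff fun_eq_iff)
  then show ?thesis
    using assms(2-)
    by (simp only:) (intro smooth_on_add smooth_on_bounded_bilinear[OF bounded_bilinear_scaleR] smooth_on_const)
qed

lemma bounded_linear_nth: "bounded_linear (\<lambda>A :: mat3. A $ i $ j)"
  unfolding linear_conv_bounded_linear[symmetric] by (auto intro!: linearI)

lemma bounded_linear_transpose: "bounded_linear (transpose :: mat3 \<Rightarrow> mat3)"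
  unfolding linear_conv_bounded_linear[symmetric]
  by (auto intro!: linearI simp: transpose_def vec_eq_iff)

lemma transpose_add: "transpose (A + B) = transpose A + transpose (B :: mat3)"
  by (simp add: transpose_def vec_eq_iff)

lemma transpose_diff: "transpose (A - B) = transpose A - transpose (B :: mat3)"
  by (simp add: transpose_def vec_eq_iff)

lemma transpose_scaleR: "transpose (r *\<^sub>R A) = r *\<^sub>R transpose (A :: mat3)"
  by (simp add: transpose_def vec_eq_iff)

lemma transpose_nth: "transpose A $ i $ j = A $ j $ i"
  by (simp add: transpose_def)

lemma subspace_Vsp: "subspace Vsp"
  by (auto simp: subspace_def Vsp_def transpose_add transpose_scaleR) (simp add: transpose_def vec_eq_iff)

lemma Vsp_iff: "A \<in> Vsp \<longleftrightarrow> A$1$2 = 0 \<and> A$2$1 = 0 \<and> A$1$3 = A$3$1 \<and> A$2$3 = A$3$2"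
  by (auto simp: Vsp_def mat3_eq_iff transpose_nth)

interpretation H: rel_open hlie Hgrp
proof
  have "open {T :: mat3. T$1$1 > 0 \<and> T$2$2 > 0 \<and> T$3$3 > 0}"
    by (intro open_Collect_conj open_Collect_less continuous_on_const
        bounded_linear.continuous_on[OF bounded_linear_nth] continuous_on_id)
  from openin_open_Int[OF this, of hlie] show "openin (top_of_set hlie) Hgrp"
    by (rule back_subst) (auto simp: Hgrp_iff)
qed (rule subspace_hlie)

text \<open>\<open>matrix_inv\<close> is a choice, so smoothness is proved from this formula, which
  is polynomial in the entries of \<open>T\<close> and the inverses of its diagonal entries.\<close>

definition linv :: "mat3 \<Rightarrow> mat3" where
  "linv T = lower (inverse (T$1$1)) (inverse (T$2$2)) (inverse (T$3$3))
    (- (T$3$1 * inverse (T$1$1) * inverse (T$3$3))) (- (T$3$2 * inverse (T$2$2) * inverse (T$3$3)))"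

lemma matrix_inv_Hgrp:
  assumes T: "T \<in> Hgrp"
  shows "matrix_inv T = linv T" "T ** matrix_inv T = mat 1" "matrix_inv T ** T = mat 1"
    "matrix_inv T \<in> Hgrp"
proof -
  have 1: "T ** linv T = mat 1" "linv T ** T = mat 1"
    using T hlieD[of T] by (simp_all add: Hgrp_iff linv_def mat3_eq_iff mat3_mult mat_def)
  then have "T ** linv T = mat 1 \<and> linv T ** T = mat 1"
    by simp
  then have "T ** matrix_inv T = mat 1 \<and> matrix_inv T ** T = mat 1"
    unfolding matrix_inv_def by (rule someI)
  then show 2: "T ** matrix_inv T = mat 1" "matrix_inv T ** T = mat 1"
    by auto
  have "matrix_inv T = linv T ** T ** matrix_inv T"
    by (simp add: 1)
  then show 3: "matrix_inv T = linv T"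
    by (simp add: 2 flip: matrix_mul_assoc)
  show "matrix_inv T \<in> Hgrp"
    using T unfolding 3 by (simp add: Hgrp_iff linv_def)
qed

lemma Hgrp_mult: "\<lbrakk>S \<in> Hgrp; T \<in> Hgrp\<rbrakk> \<Longrightarrow> S ** T \<in> Hgrp"
  using hlieD by (auto simp: Hgrp_iff hlie_mult mat3_mult)

lemma mult_inv_cancel:
  fixes A :: mat3
  assumes "T \<in> Hgrp"
  shows "A ** T ** matrix_inv T = A" "A ** matrix_inv T ** T = A"
  using matrix_inv_Hgrp[OF assms] by (simp_all flip: matrix_mul_assoc)

lemma transpose_inv_cancel:
  fixes A :: mat3
  assumes "T \<in> Hgrp"
  shows "A ** transpose T ** transpose (matrix_inv T) = A" "A ** transpose (matrix_inv T) ** transpose T = A"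
  using matrix_inv_Hgrp[OF assms]
  by (simp_all add: transpose_mat flip: matrix_mul_assoc matrix_transpose_mul)

lemma smooth_matrix_inv: "smooth_on hlie Hgrp matrix_inv"
proof -
  have "smooth_on hlie Hgrp linv"
    unfolding linv_def[abs_def]
    by (intro smooth_on_lower H.feasible_domain_axioms H.smooth_on_inverse H.smooth_on_minus
        H.smooth_on_bounded_bilinear[OF bounded_bilinear_mult]
        H.smooth_on_bounded_linear[OF bounded_linear_nth H.smooth_on_ident]) (auto simp: Hgrp_iff)
  then show ?thesis
    using smooth_on_cong[of Hgrp matrix_inv linv hlie] matrix_inv_Hgrp(1) by blast
qed

text \<open>The solution of \<open>T T^T = x\<close> row by row. The third radicand is the Schur
  complement of the upper left block; inverses stand for quotients to fit the smoothness
  rules.\<close>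

definition chol_formula :: "mat3 \<Rightarrow> mat3" where
  "chol_formula x = lower (sqrt (x$1$1)) (sqrt (x$2$2))
    (sqrt (x$3$3 - x$3$1 * x$3$1 * inverse (x$1$1) - x$3$2 * x$3$2 * inverse (x$2$2)))
    (x$3$1 * inverse (sqrt (x$1$1))) (x$3$2 * inverse (sqrt (x$2$2)))"

lemma quadratic_form_Vsp:
  assumes "x \<in> Vsp"
  shows "z \<bullet> (x *v z) = x$1$1 * (z$1)^2 + x$2$2 * (z$2)^2 + x$3$3 * (z$3)^2
    + 2 * x$3$1 * z$1 * z$3 + 2 * x$3$2 * z$2 * z$3"
  using assms by (simp add: Vsp_iff inner_vec_def sum_3 mat3_mult_vec power2_eq_square algebra_simps)

lemma Omega_minors:
  assumes "x \<in> Omega"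
  shows "x \<in> Vsp" "x$1$1 > 0" "x$2$2 > 0"
    "x$3$3 - x$3$1 * x$3$1 * inverse (x$1$1) - x$3$2 * x$3$2 * inverse (x$2$2) > 0"
proof -
  show V: "x \<in> Vsp"
    using assms by (simp add: Omega_def)
  have pos: "z \<bullet> (x *v z) > 0" if "z \<noteq> 0" for z
    using assms that by (simp add: Omega_def)
  show a: "x$1$1 > 0"
    using pos[of "vector [1, 0, 0]"] by (simp add: quadratic_form_Vsp[OF V] vec_eq_iff forall_3)
  show b: "x$2$2 > 0"
    using pos[of "vector [0, 1, 0]"] by (simp add: quadratic_form_Vsp[OF V] vec_eq_iff forall_3)
  show "x$3$3 - x$3$1 * x$3$1 * inverse (x$1$1) - x$3$2 * x$3$2 * inverse (x$2$2) > 0"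
  proof -
    have sq: "c * (d * inverse c)\<^sup>2 = d * (d * inverse c)" if "c > 0" for c d :: real
      using that by (simp add: power2_eq_square field_simps)
    show ?thesis
      \<comment> \<open>This vector minimises the quadratic form among those with third component 1;
        the minimum is the Schur complement.\<close>
      using pos[of "vector [- (x$3$1 * inverse (x$1$1)), - (x$3$2 * inverse (x$2$2)), 1]"]
      by (simp add: quadratic_form_Vsp[OF V] vec_eq_iff forall_3 sq[OF a] sq[OF b] mult.assoc)
        (simp add: ac_simps)
  qed
qed

lemma Phi_in_Omega:
  assumes T: "T \<in> Hgrp"
  shows "Phi T \<in> Omega"
  unfolding Omega_def
proof (intro CollectI conjI allI impI)
  show "Phi T \<in> Vsp"
    using T hlieD[of T] by (auto simp: Hgrp_iff Vsp_iff Phi_def mat3_mult transpose_nth)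
  fix z :: "real^3" assume z: "z \<noteq> 0"
  have "z \<bullet> (Phi T *v z) = (transpose T *v z) \<bullet> (transpose T *v z)"
    by (simp add: Phi_def dot_lmul_matrix transpose_matrix_vector flip: matrix_vector_mul_assoc)
  moreover have "transpose T *v z \<noteq> 0"
  proof
    assume 0: "transpose T *v z = 0"
    have "transpose (matrix_inv T) ** transpose T = mat 1"
      by (metis T matrix_inv_Hgrp(2) matrix_transpose_mul transpose_mat)
    then have "z = transpose (matrix_inv T) *v (transpose T *v z)"
      by (simp only: matrix_vector_mul_assoc matrix_vector_mul_lid)
    then show False
      using z by (simp only: 0 matrix_vector_mult_0_right)
  qed
  ultimately show "z \<bullet> (Phi T *v z) > 0"
    by simp
qed

text \<open>The hypotheses are inequalities rather than membership in \<open>Omega\<close>, so that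
  the lemma also serves to derive positive definiteness from them.\<close>

lemma chol_formula:
  assumes "x \<in> Vsp" "x$1$1 > 0" "x$2$2 > 0"
    "x$3$3 - x$3$1 * x$3$1 * inverse (x$1$1) - x$3$2 * x$3$2 * inverse (x$2$2) > 0"
  shows "chol_formula x \<in> Hgrp" "Phi (chol_formula x) = x"
proof -
  show "chol_formula x \<in> Hgrp"
    using assms by (simp add: Hgrp_iff chol_formula_def)
  have "sqrt (x$1$1) * sqrt (x$1$1) = x$1$1" "sqrt (x$2$2) * sqrt (x$2$2) = x$2$2"
    "sqrt (x$1$1) \<noteq> 0" "sqrt (x$2$2) \<noteq> 0"
    using assms(2,3) by auto
  moreover have "inverse (x$1$1) = inverse (sqrt (x$1$1)) * inverse (sqrt (x$1$1))"
    "inverse (x$2$2) = inverse (sqrt (x$2$2)) * inverse (sqrt (x$2$2))"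
    using calculation(1,2) by (metis inverse_mult_distrib)+
  ultimately show "Phi (chol_formula x) = x"
    using assms(1,4)
    by (simp add: mat3_eq_iff Phi_def mat3_mult transpose_nth Vsp_iff chol_formula_def mult_ac)
qed

text \<open>A left inverse of \<open>Phi\<close> on \<open>Hgrp\<close> gives the injectivity that
  evaluating \<open>inv_into\<close> requires. Positive diagonal entries select the right square
  roots.\<close>

lemma chol_formula_Phi:
  assumes T: "T \<in> Hgrp"
  shows "chol_formula (Phi T) = T"
proof -
  have *: "T$1$1 > 0" "T$2$2 > 0" "T$3$3 > 0" "T$1$2 = 0" "T$1$3 = 0" "T$2$3 = 0" "T$2$1 = 0"
    using T hlieD[of T] by (auto simp: Hgrp_iff)
  have "T$3$3 * T$3$3 = Phi T $3$3 - Phi T $3$1 * Phi T $3$1 * inverse (Phi T $1$1)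
      - Phi T $3$2 * Phi T $3$2 * inverse (Phi T $2$2)"
    using * by (simp add: Phi_def mat3_mult transpose_nth field_simps)
  then have "sqrt (Phi T $3$3 - Phi T $3$1 * Phi T $3$1 * inverse (Phi T $1$1)
      - Phi T $3$2 * Phi T $3$2 * inverse (Phi T $2$2)) = T$3$3"
    using * by (metis abs_of_pos real_sqrt_abs2)
  moreover have "sqrt (Phi T $1$1) = T$1$1" "sqrt (Phi T $2$2) = T$2$2"
    "Phi T $3$1 = T$3$1 * T$1$1" "Phi T $3$2 = T$3$2 * T$2$2"
    using * by (simp_all add: Phi_def mat3_mult transpose_nth)
  ultimately show ?thesis
    using * by (simp add: mat3_eq_iff chol_formula_def)
qed

lemma chol_Phi: "T \<in> Hgrp \<Longrightarrow> chol (Phi T) = T"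
  unfolding chol_def by (metis chol_formula_Phi inj_on_inverseI inv_into_f_f)

lemma chol:
  assumes "x \<in> Omega"
  shows "chol x \<in> Hgrp" "Phi (chol x) = x" "chol x = chol_formula x"
  using chol_formula[OF Omega_minors[OF assms]] chol_Phi by metis+

text \<open>Openness comes from a form of Sylvester's criterion: clearing denominators in the Schur
  complement gives \<open>?f\<close>, the determinant on \<open>Vsp\<close>, and strict polynomial
  inequalities are open. They imply positive definiteness because they make the Cholesky factor
  exist.\<close>

interpretation O: rel_open Vsp Omega
proof
  let ?f = "\<lambda>x :: mat3. x$1$1 * x$2$2 * x$3$3 - x$2$2 * (x$3$1 * x$3$1) - x$1$1 * (x$3$2 * x$3$2)"
  have "open {x :: mat3. x$1$1 > 0 \<and> x$2$2 > 0 \<and> ?f x > 0}"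
    by (intro open_Collect_conj open_Collect_less continuous_intros
        bounded_linear.continuous_on[OF bounded_linear_nth])
  from openin_open_Int[OF this, of Vsp]
  have "openin (top_of_set Vsp) (Vsp \<inter> {x. x$1$1 > 0 \<and> x$2$2 > 0 \<and> ?f x > 0})" .
  moreover have "x \<in> Omega \<longleftrightarrow> x \<in> Vsp \<and> x$1$1 > 0 \<and> x$2$2 > 0 \<and> ?f x > 0" for x
  proof -
    have f: "?f x = x$1$1 * x$2$2 * (x$3$3 - x$3$1 * x$3$1 * inverse (x$1$1) - x$3$2 * x$3$2 * inverse (x$2$2))"
      if "x$1$1 > 0" "x$2$2 > 0"
      using that by (simp add: field_simps)
    show ?thesis
    proof
      assume "x \<in> Omega"
      from Omega_minors[OF this] show "x \<in> Vsp \<and> x$1$1 > 0 \<and> x$2$2 > 0 \<and> ?f x > 0"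
        unfolding f[OF Omega_minors(2,3)[OF \<open>x \<in> Omega\<close>]] by (simp add: mult_pos_pos)
    next
      assume *: "x \<in> Vsp \<and> x$1$1 > 0 \<and> x$2$2 > 0 \<and> ?f x > 0"
      then have "x$3$3 - x$3$1 * x$3$1 * inverse (x$1$1) - x$3$2 * x$3$2 * inverse (x$2$2) > 0"
        using f by (metis mult_pos_pos zero_less_mult_pos)
      then show "x \<in> Omega"
        using chol_formula[of x] Phi_in_Omega * by metis
    qed
  qed
  then have "Vsp \<inter> {x. x$1$1 > 0 \<and> x$2$2 > 0 \<and> ?f x > 0} = Omega"
    by blast
  ultimately show "openin (top_of_set Vsp) Omega"
    by (rule back_subst)
qed (rule subspace_Vsp)

lemma smooth_chol: "smooth_on Vsp Omega chol"
proof -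
  note nth = O.smooth_on_bounded_linear[OF bounded_linear_nth O.smooth_on_ident]
  have "smooth_on Vsp Omega chol_formula"
    unfolding chol_formula_def[abs_def]
    by (intro smooth_on_lower O.feasible_domain_axioms O.smooth_on_inverse O.smooth_on_diff
        O.smooth_on_sqrt O.smooth_on_bounded_bilinear[OF bounded_bilinear_mult] nth)
      (use Omega_minors in \<open>auto simp: less_imp_neq[symmetric]\<close>)
  then show ?thesis
    using smooth_on_cong[of Omega chol chol_formula Vsp] chol(3) by blast
qed

section \<open>The clan connection\<close>

text \<open>An explicit form of \<open>low\<close>, linear on all matrices and therefore usable in
  smoothness proofs. The diagonal is halved because it occurs twice in
  \<open>A + transpose A\<close>.\<close>

definition lower_part :: "mat3 \<Rightarrow> mat3" where
  "lower_part u = lower (u$1$1 / 2) (u$2$2 / 2) (u$3$3 / 2) (u$3$1) (u$3$2)"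

lemma bounded_linear_lower_part: "bounded_linear lower_part"
  unfolding linear_conv_bounded_linear[symmetric]
  by (auto intro!: linearI simp: lower_part_def mat3_eq_iff field_simps)

lemma lower_part_in_hlie: "lower_part u \<in> hlie"
  by (simp add: lower_part_def)

lemma lower_part_sym: "A \<in> hlie \<Longrightarrow> lower_part (A + transpose A) = A"
  by (simp add: lower_part_def mat3_eq_iff transpose_nth hlie_def)

lemma sym_lower_part: "u \<in> Vsp \<Longrightarrow> lower_part u + transpose (lower_part u) = u"
  by (simp add: lower_part_def mat3_eq_iff transpose_nth Vsp_iff)

lemma sym_in_Vsp: "A \<in> hlie \<Longrightarrow> A + transpose A \<in> Vsp"
  by (simp add: Vsp_iff transpose_nth hlie_def)

lemma low_eq: "u \<in> Vsp \<Longrightarrow> low u = lower_part u"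
  unfolding low_def
  by (rule the_equality) (auto simp: lower_part_in_hlie sym_lower_part lower_part_sym)

lemma low_in_hlie: "u \<in> Vsp \<Longrightarrow> low u \<in> hlie"
  by (simp add: low_eq lower_part_in_hlie)

lemma low_sym: "A \<in> hlie \<Longrightarrow> low (A + transpose A) = A"
  by (simp add: low_eq sym_in_Vsp lower_part_sym)

text \<open>The derivative at t = 0 of the congruences \<open>exp(tA) x exp(tA)^T\<close>.\<close>

definition clan_act :: "mat3 \<Rightarrow> mat3 \<Rightarrow> mat3" where
  "clan_act x A = A ** x + x ** transpose A"

text \<open>Solves \<open>A x + x A^T = w\<close> for \<open>A\<close>: with
  \<open>x = T T^T\<close> and \<open>B = T^-1 A T\<close> the equation becomes
  \<open>B + B^T = T^-1 w T^-T\<close>, which \<open>lower_part\<close> inverts.\<close>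

definition clan_coord :: "mat3 \<Rightarrow> mat3 \<Rightarrow> mat3" where
  "clan_coord x w = chol x ** lower_part (matrix_inv (chol x) ** w ** transpose (matrix_inv (chol x)))
    ** matrix_inv (chol x)"

lemma congruence_in_Vsp:
  assumes "A \<in> hlie" "w \<in> Vsp"
  shows "A ** w ** transpose A \<in> Vsp"
  using hlieD[OF assms(1)] assms(2) by (simp add: Vsp_iff mat3_mult transpose_nth algebra_simps)

lemma clan_act_in_Vsp: "\<lbrakk>A \<in> hlie; x \<in> Vsp\<rbrakk> \<Longrightarrow> clan_act x A \<in> Vsp"
  using hlieD[of A] by (simp add: Vsp_iff clan_act_def mat3_mult transpose_nth algebra_simps)

lemma clan_act_coord:
  assumes x: "x \<in> Omega" and w: "w \<in> Vsp"
  shows "clan_act x (clan_coord x w) = w"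
proof -
  define T where "T = chol x"
  define B where "B = lower_part (matrix_inv T ** w ** transpose (matrix_inv T))"
  have T: "T \<in> Hgrp" "x = T ** transpose T"
    using chol[OF x] by (auto simp: T_def Phi_def)
  have B: "B + transpose B = matrix_inv T ** w ** transpose (matrix_inv T)"
    unfolding B_def using matrix_inv_Hgrp(4)[OF T(1)] w
    by (intro sym_lower_part congruence_in_Vsp) (auto simp: Hgrp_iff)
  have c: "clan_coord x w = T ** B ** matrix_inv T"
    by (simp add: clan_coord_def B_def T_def)
  have "clan_act x (clan_coord x w) = T ** B ** matrix_inv T ** T ** transpose T
      + T ** transpose T ** transpose (matrix_inv T) ** transpose B ** transpose T"
    by (simp only: clan_act_def c) (simp only: T(2) matrix_transpose_mul matrix_mul_assoc)
  also have "\<dots> = T ** (B + transpose B) ** transpose T"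
    by (simp add: mult_inv_cancel transpose_inv_cancel T mult_simps)
  also have "\<dots> = w"
    unfolding B by (simp add: matrix_mul_assoc matrix_inv_Hgrp(2,3)[OF T(1)] transpose_inv_cancel T)
  finally show ?thesis .
qed

lemma clan_coord_act:
  assumes x: "x \<in> Omega" and A: "A \<in> hlie"
  shows "clan_coord x (clan_act x A) = A"
proof -
  define T where "T = chol x"
  have T: "T \<in> Hgrp" "x = T ** transpose T"
    using chol[OF x] by (auto simp: T_def Phi_def)
  define B where "B = matrix_inv T ** A ** T"
  have B: "B \<in> hlie"
    using T(1) matrix_inv_Hgrp(4)[OF T(1)] A unfolding B_def by (intro hlie_mult) (auto simp: Hgrp_iff)
  have "matrix_inv T ** clan_act x A ** transpose (matrix_inv T) = B + transpose B"
    by (simp add: clan_act_def T(2) B_def mult_simps matrix_transpose_mul matrix_mul_assoc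
        matrix_inv_Hgrp(2,3)[OF T(1)] transpose_inv_cancel[OF T(1)])
  then have "clan_coord x (clan_act x A) = T ** B ** matrix_inv T"
    unfolding clan_coord_def T_def[symmetric] using lower_part_sym[OF B] by simp
  also have "\<dots> = A"
    by (simp add: B_def matrix_mul_assoc matrix_inv_Hgrp(2,3)[OF T(1)] mult_inv_cancel[OF T(1)])
  finally show ?thesis .
qed

lemmas lower_part_linear =
  linear_add[OF bounded_linear.linear[OF bounded_linear_lower_part]]
  linear_scale[OF bounded_linear.linear[OF bounded_linear_lower_part]]

section \<open>The frames on the group and on the cone, and identification of the
  connections\<close>

interpretation H: framed hlie Hgrp hlie "\<lambda>T w. w ** matrix_inv T" "\<lambda>T A. A ** T"
proof (rule framed.intro[OF H.rel_open_axioms framed_axioms.intro])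
  fix T A assume T: "T \<in> Hgrp"
  show "linear (\<lambda>w :: mat3. w ** matrix_inv T)" "linear (\<lambda>A :: mat3. A ** T)"
    by (auto intro!: linearI simp: mult_simps)
  assume A: "A \<in> hlie"
  show "A ** matrix_inv T \<in> hlie" "A ** T \<in> hlie"
    using A T matrix_inv_Hgrp(4)[OF T] by (auto simp: Hgrp_iff intro!: hlie_mult)
  show "A ** matrix_inv T ** T = A" "A ** T ** matrix_inv T = A"
    by (simp_all add: mult_inv_cancel T)
next
  fix Y :: "mat3 \<Rightarrow> mat3" assume "smooth_on hlie Hgrp Y"
  then show "smooth_on hlie Hgrp (\<lambda>T. Y T ** matrix_inv T)" "smooth_on hlie Hgrp (\<lambda>T. Y T ** T)"
    using H.smooth_on_bounded_bilinear[OF bounded_bilinear_matrix_mult _ smooth_matrix_inv]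
      H.smooth_on_bounded_bilinear[OF bounded_bilinear_matrix_mult _ H.smooth_on_ident] by auto
qed (rule subspace_hlie)

interpretation O: framed Vsp Omega hlie clan_coord clan_act
proof (rule framed.intro[OF O.rel_open_axioms framed_axioms.intro])
  fix x assume x: "x \<in> Omega"
  show "linear (clan_coord x)"
    by (rule linearI) (simp_all add: clan_coord_def mult_simps lower_part_linear)
  show "linear (clan_act x)"
    by (rule linearI) (simp_all add: clan_act_def mult_simps transpose_add transpose_scaleR algebra_simps)
  show "clan_coord x w \<in> hlie" for w
    unfolding clan_coord_def using chol(1)[OF x] matrix_inv_Hgrp(4)[OF chol(1)[OF x]]
    by (auto simp: Hgrp_iff intro!: hlie_mult lower_part_in_hlie)
  show "clan_act x A \<in> Vsp" if "A \<in> hlie" for A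
    using clan_act_in_Vsp that Omega_minors(1)[OF x] by blast
  show "clan_act x (clan_coord x w) = w" if "w \<in> Vsp" for w
    by (rule clan_act_coord[OF x that])
  show "clan_coord x (clan_act x A) = A" if "A \<in> hlie" for A
    by (rule clan_coord_act[OF x that])
next
  fix Y :: "mat3 \<Rightarrow> mat3" assume Y: "smooth_on Vsp Omega Y"
  have inv: "smooth_on Vsp Omega (\<lambda>x. matrix_inv (chol x))"
    by (rule smooth_on_compose[OF O.feasible_domain_axioms H.rel_open_axioms smooth_chol _ smooth_matrix_inv])
      (use chol(1) in blast)
  show "smooth_on Vsp Omega (\<lambda>x. clan_coord x (Y x))"
    unfolding clan_coord_def
    by (intro O.smooth_on_bounded_bilinear[OF bounded_bilinear_matrix_mult]
        O.smooth_on_bounded_linear[OF bounded_linear_lower_part]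
        O.smooth_on_bounded_linear[OF bounded_linear_transpose] inv Y smooth_chol)
  show "smooth_on Vsp Omega (\<lambda>x. clan_act x (Y x))"
    unfolding clan_act_def
    by (intro O.smooth_on_add O.smooth_on_bounded_bilinear[OF bounded_bilinear_matrix_mult]
        O.smooth_on_bounded_linear[OF bounded_linear_transpose] O.smooth_on_ident Y)
qed (rule subspace_hlie)

text \<open>Right translation preserves frame coordinates, \<open>(w S) (T S)^-1 = w T^-1\<close>,
  so it transports the frame connection to itself.\<close>

lemma right_invariant_H: "right_invariant H.conn"
  unfolding right_invariant_def
proof
  fix S assume S: "S \<in> Hgrp"
  have lin: "bounded_linear (\<lambda>T :: mat3. T ** R)" for R :: mat3
    unfolding linear_conv_bounded_linear[symmetric] by (auto intro!: linearI simp: mult_simps)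
  show "push_conn Hgrp hlie Hgrp (\<lambda>T. T ** S) (\<lambda>T. T ** matrix_inv S) H.conn = H.conn"
  proof (rule push_frame_conn[OF H.framed_axioms H.framed_axioms])
    show "smooth_on hlie Hgrp (\<lambda>T. T ** S)" "smooth_on hlie Hgrp (\<lambda>T. T ** matrix_inv S)"
      by (intro H.smooth_on_bounded_linear[OF lin] H.smooth_on_ident)+
    show "(\<lambda>T. T ** S) ` Hgrp \<subseteq> Hgrp" "(\<lambda>T. T ** matrix_inv S) ` Hgrp \<subseteq> Hgrp"
      using S matrix_inv_Hgrp(4)[OF S] by (auto simp: Hgrp_mult)
    fix T w assume T: "T \<in> Hgrp"
    show "T ** S ** matrix_inv S = T" "T ** matrix_inv S ** S = T"
      by (simp_all add: mult_inv_cancel S)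
    assume w: "w \<in> hlie"
    have "dird Hgrp (\<lambda>T. T ** S) T w = w ** S"
      using H.dird_eq[OF bounded_linear.has_derivative[OF lin has_derivative_ident] T w] .
    moreover have "w ** S ** matrix_inv (T ** S) = w ** matrix_inv T"
    proof -
      have "w ** matrix_inv T = w ** matrix_inv T ** (T ** S) ** matrix_inv (T ** S)"
        by (rule mult_inv_cancel(1)[symmetric]) (rule Hgrp_mult[OF T S])
      then show ?thesis
        by (simp add: matrix_mul_assoc mult_inv_cancel(2)[OF T])
    qed
    ultimately show "dird Hgrp (\<lambda>T. T ** S) T w ** matrix_inv (T ** S) = w ** matrix_inv T"
      by simp
  qed
qed

lemma right_inv_field_eq: "right_inv_field A = frame_field Hgrp (\<lambda>T A. A ** T) A"
  by (simp add: right_inv_field_def frame_field_def)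

lemma nabla_H_eq: "nabla_H = H.conn"
  unfolding nabla_H_def right_inv_field_eq
proof (rule the_equality)
  show "affine_connection hlie Hgrp H.conn \<and> right_invariant H.conn \<and>
    (\<forall>A\<in>hlie. parallel_field hlie Hgrp H.conn (frame_field Hgrp (\<lambda>T A. A ** T) A))"
    using H.affine_frame_conn right_invariant_H H.frame_field_parallel by blast
qed (use H.conn_unique in blast)

lemma nabla_cl_eq: "nabla_cl = O.conn"
  unfolding nabla_cl_def nabla_H_eq
proof (rule push_frame_conn[OF H.framed_axioms O.framed_axioms _ _ smooth_chol])
  show "smooth_on hlie Hgrp Phi"
    unfolding Phi_def[abs_def]
    by (intro H.smooth_on_bounded_bilinear[OF bounded_bilinear_matrix_mult] H.smooth_on_ident
        H.smooth_on_bounded_linear[OF bounded_linear_transpose])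
  show "Phi ` Hgrp \<subseteq> Omega" "chol ` Omega \<subseteq> Hgrp"
    using Phi_in_Omega chol(1) by auto
  show "Phi (chol y) = y" if "y \<in> Omega" for y
    using chol(2)[OF that] .
  fix T w assume T: "T \<in> Hgrp"
  show "chol (Phi T) = T"
    by (rule chol_Phi[OF T])
  assume w: "w \<in> hlie"
  have "(Phi has_derivative (\<lambda>w. T ** transpose w + w ** transpose T)) (at T within Hgrp)"
    unfolding Phi_def[abs_def]
    by (intro bounded_bilinear.FDERIV[OF bounded_bilinear_matrix_mult] has_derivative_ident
        bounded_linear.has_derivative[OF bounded_linear_transpose])
  then have "dird Hgrp Phi T w = T ** transpose w + w ** transpose T"
    using H.dird_eq T w by blast
  \<comment> \<open>With \<open>A = w T^-1\<close> one has \<open>w T^T = A T T^T\<close>, so a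
    tangent vector keeps its coordinate under the differential of \<open>Phi\<close>.\<close>
  also have "\<dots> = clan_act (Phi T) (w ** matrix_inv T)"
    by (simp add: clan_act_def Phi_def matrix_mul_assoc matrix_transpose_mul mult_inv_cancel[OF T]
        transpose_inv_cancel[OF T])
  finally show "clan_coord (Phi T) (dird Hgrp Phi T w) = w ** matrix_inv T"
    using clan_coord_act[OF Phi_in_Omega[OF T] H.theta_in[OF T w]] by simp
qed

interpretation O: affine_conn Vsp Omega nabla_cl
  by unfold_locales (simp add: nabla_cl_eq O.affine_frame_conn)

section \<open>Clan fields and torsion\<close>

lemma clan_field_eq: "clan_field v = frame_field Omega clan_act (low v)"
  by (auto simp: clan_field_def frame_field_def clan_act_def clan_prod_def)

lemma clan_field_in: "v \<in> Vsp \<Longrightarrow> clan_field v \<in> vector_fields Vsp Omega"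
  unfolding clan_field_eq by (intro O.frame_field_in low_in_hlie)

lemma nabla_cl_clan_field:
  assumes "u \<in> Vsp" "v \<in> Vsp"
  shows "nabla_cl (clan_field u) (clan_field v) = (\<lambda>x. 0)"
  using O.frame_field_parallel[OF low_in_hlie[OF assms(2)]] clan_field_in[OF assms(1)]
  unfolding parallel_field_def nabla_cl_eq clan_field_eq by blast

text \<open>Writing \<open>u = A + A^T\<close> and \<open>v = B + B^T\<close>, the mixed terms
  \<open>A B^T\<close> and \<open>B A^T\<close> cancel, and the difference is the commutator plus
  its transpose.\<close>

lemma low_clan_commutator:
  assumes "u \<in> Vsp" "v \<in> Vsp"
  shows "low (u \<Delta> v - v \<Delta> u) = low u ** low v - low v ** low u"
proof -
  define A B where "A = low u" and "B = low v"
  have A: "A \<in> hlie" "u = A + transpose A" and B: "B \<in> hlie" "v = B + transpose B"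
    using assms by (auto simp: A_def B_def lower_part_in_hlie low_eq sym_lower_part)
  have "u \<Delta> v - v \<Delta> u = (A ** B - B ** A) + transpose (A ** B - B ** A)"
    unfolding clan_prod_def A_def[symmetric] B_def[symmetric] A(2) B(2)
    by (simp add: low_sym[OF A(1)] low_sym[OF B(1)] mult_simps matrix_transpose_mul transpose_add transpose_diff)
  then show ?thesis
    using low_sym[OF subspace_diff[OF subspace_hlie hlie_mult[OF A(1) B(1)] hlie_mult[OF B(1) A(1)]]]
    by (simp add: A_def B_def)
qed

lemma dird_clan_field:
  assumes x: "x \<in> Omega" and w: "w \<in> Vsp"
  shows "dird Omega (clan_field v) x w = clan_act w (low v)"
proof -
  have lin: "bounded_linear (\<lambda>x. clan_act x A)" for A
    unfolding linear_conv_bounded_linear[symmetric]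
    by (rule linearI) (simp_all add: clan_act_def mult_simps algebra_simps)
  have "dird Omega (clan_field v) x = dird Omega (\<lambda>x. clan_act x (low v)) x"
    by (rule dird_transform[OF _ x]) (simp add: clan_field_eq frame_field_def)
  then show ?thesis
    using O.dird_eq[OF bounded_linear.has_derivative[OF lin has_derivative_ident] x w] by simp
qed

text \<open>Both covariant derivatives vanish, so the torsion is minus the Lie bracket. For these
  fields, linear in \<open>x\<close>, the bracket belongs to minus the commutator, and the two signs
  cancel.\<close>

lemma torsion_clan_field:
  assumes u: "u \<in> Vsp" and v: "v \<in> Vsp"
  shows "torsion Omega nabla_cl (clan_field u) (clan_field v) = clan_field (u \<Delta> v - v \<Delta> u)"
proof
  fix x
  show "torsion Omega nabla_cl (clan_field u) (clan_field v) x = clan_field (u \<Delta> v - v \<Delta> u) x"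
  proof (cases "x \<in> Omega")
    case x: True
    have act: "clan_field v x = clan_act x (low v)" for v
      using x by (simp add: clan_field_eq frame_field_def)
    have V: "clan_act x (low v) \<in> Vsp" if "v \<in> Vsp" for v
      using clan_act_in_Vsp[OF low_in_hlie[OF that] Omega_minors(1)[OF x]] .
    show ?thesis
      unfolding torsion_def nabla_cl_clan_field[OF u v] nabla_cl_clan_field[OF v u] act
        low_clan_commutator[OF u v]
      using x
      by (simp add: lie_bracket_def act dird_clan_field[OF x V[OF u]] dird_clan_field[OF x V[OF v]])
        (simp add: clan_act_def mult_simps matrix_transpose_mul matrix_mul_assoc transpose_add transpose_diff)
  qed (simp add: torsion_def nabla_cl_clan_field u v lie_bracket_def clan_field_eq[of "u \<Delta> v - v \<Delta> u"]
      frame_field_def)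
qed

section \<open>Integral curves and the Cholesky-Vinberg path\<close>

lemma eta_eq: "eta x v t = mexp (t *\<^sub>R low v) ** x ** transpose (mexp (t *\<^sub>R low v))"
  by (simp add: eta_def mexp_transpose transpose_scaleR)

lemma eta_Phi:
  assumes "x \<in> Omega"
  shows "eta x v t = Phi (mexp (t *\<^sub>R low v) ** chol x)"
  using chol(2)[OF assms] by (simp add: eta_eq Phi_def matrix_transpose_mul matrix_mul_assoc)
    (metis matrix_mul_assoc)

lemma congruence_in_Omega:
  assumes "S \<in> Hgrp" "x \<in> Omega"
  shows "S ** x ** transpose S \<in> Omega"
proof -
  have "S ** x ** transpose S = Phi (S ** chol x)"
    using chol(2)[OF assms(2)] unfolding Phi_def matrix_transpose_mul by (metis matrix_mul_assoc)
  then show ?thesis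
    using assms chol(1) by (simp add: Phi_in_Omega Hgrp_mult)
qed

lemma mexp_scaleR_in_Hgrp: "A \<in> hlie \<Longrightarrow> mexp (t *\<^sub>R A) \<in> Hgrp"
  by (intro mexp_in_Hgrp subspace_scale subspace_hlie)

lemma eta_integral_curve:
  assumes x: "x \<in> Omega" and v: "v \<in> Vsp" and I: "param_interval I"
  shows "integral_curve Omega (clan_field v) I (eta x v)"
  unfolding integral_curve_def
proof (intro conjI ballI)
  fix t
  show O: "eta x v t \<in> Omega"
    unfolding eta_eq by (intro congruence_in_Omega mexp_scaleR_in_Hgrp low_in_hlie v x)
  let ?A = "low v"
  have 1: "((\<lambda>t. mexp (t *\<^sub>R ?A) ** x) has_vector_derivative ?A ** mexp (t *\<^sub>R ?A) ** x) (at t within I)"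
    using bounded_linear.has_vector_derivative[OF bounded_bilinear.bounded_linear_left[OF
          bounded_bilinear_matrix_mult] mexp_deriv] .
  have "(eta x v has_vector_derivative
      (mexp (t *\<^sub>R ?A) ** x) ** transpose (?A ** mexp (t *\<^sub>R ?A))
      + (?A ** mexp (t *\<^sub>R ?A) ** x) ** transpose (mexp (t *\<^sub>R ?A))) (at t within I)"
    unfolding eta_eq[abs_def]
    by (intro bounded_bilinear.has_vector_derivative[OF bounded_bilinear_matrix_mult] 1
        bounded_linear.has_vector_derivative[OF bounded_linear_transpose] mexp_deriv)
  moreover have "clan_field v (eta x v t) = (mexp (t *\<^sub>R ?A) ** x) ** transpose (?A ** mexp (t *\<^sub>R ?A))
      + (?A ** mexp (t *\<^sub>R ?A) ** x) ** transpose (mexp (t *\<^sub>R ?A))"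
    using O by (simp add: clan_field_eq frame_field_def clan_act_def eta_eq matrix_transpose_mul matrix_mul_assoc)
  ultimately show "(eta x v has_vector_derivative clan_field v (eta x v t)) (at t within I)"
    by simp
qed (rule I)

lemma eta_zero: "eta x v 0 = x"
  by (simp add: eta_def mexp_zero)

text \<open>By \<open>sandwich_ode_unique\<close>, transporting \<open>c t\<close> back to time 0
  gives a matrix independent of \<open>t\<close>. The interval may miss 0, so the base point
  \<open>x\<close> is computed from an arbitrary time \<open>s\<close>.\<close>

lemma integral_curve_clan_field_eta:
  assumes v: "v \<in> Vsp" and c: "integral_curve Omega (clan_field v) I c"
  shows "\<exists>x\<in>Omega. \<forall>t\<in>I. c t = eta x v t"
proof -
  let ?A = "low v"
  have I: "is_interval I" "interior I \<noteq> {}" and cO: "\<And>t. t \<in> I \<Longrightarrow> c t \<in> Omega"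
    and c': "\<And>t. t \<in> I \<Longrightarrow> (c has_vector_derivative clan_field v (c t)) (at t within I)"
    using c by (auto simp: integral_curve_def param_interval_def)
  obtain s where s: "s \<in> I"
    using I(2) interior_subset by blast
  define x where "x = mexp (- s *\<^sub>R ?A) ** c s ** transpose (mexp (- s *\<^sub>R ?A))"
  have "x \<in> Omega"
    unfolding x_def by (intro congruence_in_Omega mexp_scaleR_in_Hgrp low_in_hlie v cO s)
  moreover have "c t = eta x v t" if t: "t \<in> I" for t
  proof -
    have tr: "transpose (mexp (r *\<^sub>R ?A)) = mexp (r *\<^sub>R transpose ?A)" for r
      by (simp add: mexp_transpose transpose_scaleR)
    have "(c has_vector_derivative ?A ** c t + c t ** transpose ?A) (at t within I)" if "t \<in> I" for t
      using c'[OF that] cO[OF that] by (simp add: clan_field_eq frame_field_def clan_act_def)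
    from sandwich_ode_unique[OF is_interval_convex[OF I(1)] this s t]
    have x: "x = mexp (- t *\<^sub>R ?A) ** c t ** mexp (- t *\<^sub>R transpose ?A)"
      unfolding x_def tr .
    have "eta x v t = (mexp (t *\<^sub>R ?A) ** mexp (- (t *\<^sub>R ?A))) ** c t
        ** (mexp (- (t *\<^sub>R transpose ?A)) ** mexp (t *\<^sub>R transpose ?A))"
      unfolding eta_def x by (simp add: matrix_mul_assoc)
    then show ?thesis
      by (simp add: mexp_mult_minus mexp_minus_mult)
  qed
  ultimately show ?thesis
    by blast
qed

lemma clan_integral_curve_geodesic:
  "\<lbrakk>v \<in> Vsp; integral_curve Omega (clan_field v) I c\<rbrakk> \<Longrightarrow> geodesic Omega nabla_cl I c"
  by (rule O.integral_curve_geodesic[OF clan_field_in nabla_cl_clan_field])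

text \<open>An element of \<open>Vsp\<close> is recovered from its lower part by symmetrisation, so
  the definite description has exactly one solution once the prescribed lower part is known to lie
  in \<open>hlie\<close>.\<close>

lemma cv_vec:
  assumes x: "x \<in> Omega" and y: "y \<in> Omega"
  shows "cv_vec x y \<in> Vsp"
    and "low (cv_vec x y) = chol x ** mlog (matrix_inv (chol x) ** chol y) ** matrix_inv (chol x)"
proof -
  define A where "A = chol x ** mlog (matrix_inv (chol x) ** chol y) ** matrix_inv (chol x)"
  have "A \<in> hlie"
    using chol(1)[OF x] matrix_inv_Hgrp(4)[OF chol(1)[OF x]]
      mlog_Hgrp(1)[OF Hgrp_mult[OF matrix_inv_Hgrp(4)[OF chol(1)[OF x]] chol(1)[OF y]]]
    unfolding A_def by (intro hlie_mult) (auto simp: Hgrp_iff)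
  then have "A + transpose A \<in> Vsp \<and> low (A + transpose A) = A"
    by (simp add: sym_in_Vsp low_sym)
  moreover have "v = A + transpose A" if "v \<in> Vsp" "low v = A" for v
    using that sym_lower_part[OF that(1)] by (simp add: low_eq)
  ultimately have "cv_vec x y \<in> Vsp \<and> low (cv_vec x y) = A"
    unfolding cv_vec_def A_def[symmetric] by (rule theI2[where a="A + transpose A"]) auto
  then show "cv_vec x y \<in> Vsp"
    and "low (cv_vec x y) = chol x ** mlog (matrix_inv (chol x) ** chol y) ** matrix_inv (chol x)"
    by (auto simp: A_def)
qed

text \<open>Both sides are \<open>Phi\<close> of a curve in the group, and \<open>T\<close>
  intertwines \<open>t L\<close> with \<open>t\<close> times its conjugate. The equality holds for
  every real \<open>t\<close>, so that the path can be rewritten as a function when it is shown to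
  be a geodesic.\<close>

lemma eta_cv_vec:
  assumes x: "x \<in> Omega" and y: "y \<in> Omega"
  shows "eta x (cv_vec x y) = cv_path x y"
proof
  fix t
  define T where "T = chol x"
  define L where "L = mlog (matrix_inv T ** chol y)"
  have T: "T \<in> Hgrp"
    by (simp add: T_def chol(1)[OF x])
  have low: "low (cv_vec x y) = T ** L ** matrix_inv T"
    by (simp add: cv_vec(2)[OF x y] T_def L_def)
  have "T ** (t *\<^sub>R L) = (t *\<^sub>R low (cv_vec x y)) ** T"
    by (simp add: low mult_simps mult_inv_cancel[OF T])
  from mexp_intertwine[OF this] show "eta x (cv_vec x y) t = cv_path x y t"
    by (simp add: eta_Phi[OF x] cv_path_def mpow_def flip: T_def L_def)
qed

theorem proposition6p13:
  shows "affine_connection Vsp Omega nabla_cl \<and> flat_connection Vsp Omega nabla_cl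
    \<and> (\<forall>u\<in>Vsp. \<forall>v\<in>Vsp.
         torsion Omega nabla_cl (clan_field u) (clan_field v) = clan_field (u \<Delta> v - v \<Delta> u))
    \<and> (\<forall>v\<in>Vsp.
         (\<forall>x\<in>Omega. integral_curve Omega (clan_field v) UNIV (eta x v) \<and> eta x v 0 = x) \<and>
         (\<forall>I c. integral_curve Omega (clan_field v) I c \<longrightarrow>
            geodesic Omega nabla_cl I c \<and> (\<exists>x\<in>Omega. \<forall>t\<in>I. c t = eta x v t)))
    \<and> (\<forall>x\<in>Omega. \<forall>y\<in>Omega.
         cv_vec x y \<in> Vsp \<and>
         low (cv_vec x y) = chol x ** mlog (matrix_inv (chol x) ** chol y) ** matrix_inv (chol x) \<and>
         (\<forall>t\<in>{0..1}. eta x (cv_vec x y) t = cv_path x y t) \<and>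
         geodesic Omega nabla_cl {0..1} (cv_path x y))"
proof (intro conjI ballI allI impI)
  show "affine_connection Vsp Omega nabla_cl" "flat_connection Vsp Omega nabla_cl"
    by (simp_all add: nabla_cl_eq O.affine_frame_conn O.flat_frame_conn)
next
  fix x v assume "v \<in> Vsp" "x \<in> Omega"
  then show "integral_curve Omega (clan_field v) UNIV (eta x v)"
    by (intro eta_integral_curve) (auto simp: param_interval_def)
next
  fix x y assume x: "x \<in> Omega" and y: "y \<in> Omega"
  show "geodesic Omega nabla_cl {0..1} (cv_path x y)"
    unfolding eta_cv_vec[OF x y, symmetric]
    by (rule clan_integral_curve_geodesic[OF cv_vec(1)[OF x y] eta_integral_curve[OF x cv_vec(1)[OF x y]]])
      (simp add: param_interval_def is_interval_cc)
qed (auto simp: torsion_clan_field eta_zero clan_integral_curve_geodesic integral_curve_clan_field_eta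
    cv_vec eta_cv_vec)

end
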